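(* Consider the SEA model (see context) on $\mathcal{X}\subseteq\mathbb{R}^d$ with horizon $T$. Assume there are constants $G,D,L,\lambda>0$ and $\sigma_{\max}^2,\Sigma_{\max}^2\ge0$ with $\sigma_{\max}^2+\Sigma_{\max}^2>0$ such that: (i) $\max_{\mathbf{x}\in\mathcal{X}}\|\nabla f_t(\mathbf{x})\|_2\le G$ for every individual function $f_t$, $t\in[T]$; (ii) $\mathbf{0}\in\mathcal{X}$ and $\|\mathbf{x}-\mathbf{y}\|_2\le D$ for all $\mathbf{x},\mathbf{y}\in\mathcal{X}$; (iii) $\sigma_t^2\le\sigma_{\max}^2$ and $\sup_{\mathbf{x}\in\mathcal{X}}\|\nabla F_t(\mathbf{x})-\nabla F_{t-1}(\mathbf{x})\|_2^2\le\Sigma_{\max}^2$ for all $t\in[T]$; (iv) every expected function $F_t$ is $L$-smooth on $\mathcal{X}$, i.e. $\|\nabla F_t(\mathbf{x})-\nabla F_t(\mathbf{y})\|_2\le L\|\mathbf{x}-\mathbf{y}\|_2$ for all $\mathbf x,\mathbf y\in\mathcal X$; (v) every expected function $F_t$ is $\lambda$-strongly convex on $\mathcal{X}$ with respect to $\|\cdot\|_2$. Run optimistic follow-the-regularized-leader: let $\mathbf{x}_0\in\mathcal{X}$ be arbitrary, $\ell_t(\mathbf{x})=\langle\nabla f_t(\mathbf{x}_t),\mathbf{x}-\mathbf{x}_t\rangle+\frac\lambda2\|\mathbf{x}-\mathbf{x}_t\|_2^2$, $M_1=\nabla f_0(\mathbf{x}_0)=\mathbf 0$, $M_{t+1}=\nabla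 f_t(\mathbf{x}_t)$, and for $t\ge0$ $$\mathbf{x}_{t+1}=\arg\min_{\mathbf{x}\in\mathcal{X}}\Big\{\frac\lambda2\|\mathbf{x}-\mathbf{x}_0\|_2^2+\sum_{s=1}^t\ell_s(\mathbf{x})+\langle M_{t+1},\mathbf{x}\rangle\Big\}.$$ Then for every fixed $\mathbf{u}\in\mathcal{X}$, $$\mathbb{E}\Big[\sum_{t=1}^T f_t(\mathbf{x}_t)-\sum_{t=1}^T f_t(\mathbf{u})\Big]\le\mathcal{O}\Big(\frac1\lambda(\sigma_{\max}^2+\Sigma_{\max}^2)\log\frac{\sigma_{1:T}^2+\Sigma_{1:T}^2}{\sigma_{\max}^2+\Sigma_{\max}^2}\Big).$$
   Context: SEA (Stochastically Extended Adversarial) model: $d,T\ge1$, $[T]=\{1,\dots,T\}$, and $\mathcal{X}\subseteq\mathbb{R}^d$ is a nonempty closed convex feasible domain. In each round $t\in[T]$ the learner selects $\mathbf{x}_t\in\mathcal{X}$ based on the previously observed functions $f_1,\dots,f_{t-1}$; nature chooses a distribution $\mathfrak{D}_t$ over differentiable functions $\mathcal{X}\to\mathbb{R}$ (possibly random, depending on the past); then the individual (random) function $f_t$ is sampled from $\mathfrak{D}_t$ (i.e. conditionally on the past and on $\mathfrak{D}_t$, $f_t$ has law $\mathfrak{D}_t$), the learner suffers $f_t(\mathbf{x}_t)$ and observes $f_t$. The (conditional) expected function is $F_t(\mathbf{x})=\mathbb{E}_{f_t\sim\mathfrak{D}_t}[f_t(\mathbf{x})]$, and differentiation and expectation may be interchanged: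 $\nabla F_t(\mathbf{x})=\mathbb{E}_{f_t\sim\mathfrak{D}_t}[\nabla f_t(\mathbf{x})]$. Define $$\sigma_t^2=\sup_{\mathbf{x}\in\mathcal{X}}\mathbb{E}_{f_t\sim\mathfrak{D}_t}\big[\|\nabla f_t(\mathbf{x})-\nabla F_t(\mathbf{x})\|_2^2\big],\quad \sigma_{1:T}^2=\mathbb{E}\Big[\sum_{t=1}^T\sigma_t^2\Big],\quad \Sigma_{1:T}^2=\mathbb{E}\Big[\sum_{t=1}^T\sup_{\mathbf{x}\in\mathcal{X}}\|\nabla F_t(\mathbf{x})-\nabla F_{t-1}(\mathbf{x})\|_2^2\Big],$$ with $\nabla F_0\equiv\mathbf 0$. The $\mathcal{O}$-notation means: bounded by $\frac{C}{\lambda}(\sigma_{\max}^2+\Sigma_{\max}^2)\log\big(1+\frac{\sigma_{1:T}^2+\Sigma_{1:T}^2}{\sigma_{\max}^2+\Sigma_{\max}^2}\big)+C'$ with $C$ a universal constant and $C'$ depending only on $D,G,L,\lambda,\sigma_{\max}^2,\Sigma_{\max}^2$ (not on $T$). *)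

theory Defs
  imports "HOL-Probability.Probability"
begin

(* The domain X may have empty interior, in which case the gradient relative to X is not unique.
   Hence the gradient enters as an operator that picks, for each function differentiable within X,
   one vector representing its derivative. If X has nonempty interior, the gradient is determined
   by this property on all of X. *)
definition gradient_operator_on ::
    "'a::euclidean_space set \<Rightarrow> (('a \<Rightarrow> real) \<Rightarrow> 'a \<Rightarrow> 'a) \<Rightarrow> bool" where
  "gradient_operator_on X grad \<longleftrightarrow>
     (\<forall>\<phi> x. x \<in> X \<longrightarrow> \<phi> differentiable (at x within X) \<longrightarrow>
        (\<phi> has_derivative (\<lambda>h. grad \<phi> x \<bullet> h)) (at x within X))"

definition strongly_convex_on ::
    "'a::real_inner set \<Rightarrow> real \<Rightarrow> ('a \<Rightarrow> real) \<Rightarrow> bool" where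
  "strongly_convex_on X lam \<phi> \<longleftrightarrow>
     (\<forall>x\<in>X. \<forall>y\<in>X. \<forall>\<theta>\<in>{0..1}.
        \<phi> (\<theta> *\<^sub>R x + (1 - \<theta>) *\<^sub>R y)
          \<le> \<theta> * \<phi> x + (1 - \<theta>) * \<phi> y - lam / 2 * \<theta> * (1 - \<theta>) * (norm (x - y))\<^sup>2)"

(* Throughout, \<DD> t w is the distribution of round t at the sample point w, f t w the individual
   function of round t, and S the measurable space of functions on which the distributions live. *)

definition exp_fun ::
    "(nat \<Rightarrow> 'w \<Rightarrow> ('a \<Rightarrow> real) measure) \<Rightarrow> nat \<Rightarrow> 'w \<Rightarrow> 'a \<Rightarrow> real" where
  "exp_fun \<DD> t w x = (\<integral>\<phi>. \<phi> x \<partial>\<DD> t w)"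

definition grad_exp_fun ::
    "(('a \<Rightarrow> real) \<Rightarrow> 'a \<Rightarrow> 'a::euclidean_space) \<Rightarrow> (nat \<Rightarrow> 'w \<Rightarrow> ('a \<Rightarrow> real) measure)
      \<Rightarrow> nat \<Rightarrow> 'w \<Rightarrow> 'a \<Rightarrow> 'a" where
  "grad_exp_fun grad \<DD> t w x = (if t = 0 then 0 else grad (exp_fun \<DD> t w) x)"

(* The suprema are taken in [0, \<infinity>], so that no boundedness or integrability is presupposed. *)

definition stoch_var ::
    "'a::euclidean_space set \<Rightarrow> (('a \<Rightarrow> real) \<Rightarrow> 'a \<Rightarrow> 'a)
      \<Rightarrow> (nat \<Rightarrow> 'w \<Rightarrow> ('a \<Rightarrow> real) measure) \<Rightarrow> nat \<Rightarrow> 'w \<Rightarrow> ennreal" where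
  "stoch_var X grad \<DD> t w =
     (SUP x\<in>X. \<integral>\<^sup>+\<phi>. ennreal ((norm (grad \<phi> x - grad_exp_fun grad \<DD> t w x))\<^sup>2) \<partial>\<DD> t w)"

definition adv_var ::
    "'a::euclidean_space set \<Rightarrow> (('a \<Rightarrow> real) \<Rightarrow> 'a \<Rightarrow> 'a)
      \<Rightarrow> (nat \<Rightarrow> 'w \<Rightarrow> ('a \<Rightarrow> real) measure) \<Rightarrow> nat \<Rightarrow> 'w \<Rightarrow> ennreal" where
  "adv_var X grad \<DD> t w =
     (SUP x\<in>X. ennreal ((norm (grad_exp_fun grad \<DD> t w x - grad_exp_fun grad \<DD> (t - 1) w x))\<^sup>2))"

definition cum_stoch_var ::
    "'w measure \<Rightarrow> 'a::euclidean_space set \<Rightarrow> (('a \<Rightarrow> real) \<Rightarrow> 'a \<Rightarrow> 'a)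
      \<Rightarrow> (nat \<Rightarrow> 'w \<Rightarrow> ('a \<Rightarrow> real) measure) \<Rightarrow> nat \<Rightarrow> real" where
  "cum_stoch_var M X grad \<DD> T = enn2real (\<integral>\<^sup>+w. (\<Sum>t=1..T. stoch_var X grad \<DD> t w) \<partial>M)"

definition cum_adv_var ::
    "'w measure \<Rightarrow> 'a::euclidean_space set \<Rightarrow> (('a \<Rightarrow> real) \<Rightarrow> 'a \<Rightarrow> 'a)
      \<Rightarrow> (nat \<Rightarrow> 'w \<Rightarrow> ('a \<Rightarrow> real) measure) \<Rightarrow> nat \<Rightarrow> real" where
  "cum_adv_var M X grad \<DD> T = enn2real (\<integral>\<^sup>+w. (\<Sum>t=1..T. adv_var X grad \<DD> t w) \<partial>M)"

(* The information available immediately before f t is drawn: the sigma-algebra generated by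
   f 1, ..., f (t - 1) and \<DD> 1, ..., \<DD> t. *)
definition past ::
    "'w measure \<Rightarrow> 'f measure \<Rightarrow> (nat \<Rightarrow> 'w \<Rightarrow> 'f) \<Rightarrow> (nat \<Rightarrow> 'w \<Rightarrow> 'f measure)
      \<Rightarrow> nat \<Rightarrow> 'w measure" where
  "past M S f \<DD> t = sigma (space M)
     ((\<Union>s\<in>{1..<t}. {f s -` A \<inter> space M |A. A \<in> sets S}) \<union>
      (\<Union>s\<in>{1..t}. {\<DD> s -` B \<inter> space M |B. B \<in> sets (prob_algebra S)}))"

(* Only the space and the sigma-algebra of S matter, not its measure. The joint measurability
   assumptions make f t w (x t w) and grad (f t w) (x t w) random variables for random points
   x t w in X; the last two assumptions are needed for the expectations of the two variation
   quantities to be defined. *)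
locale sea_model = prob_space M
  for M :: "'w measure" +
  fixes X :: "'a::euclidean_space set"
    and S :: "('a \<Rightarrow> real) measure"
    and grad :: "('a \<Rightarrow> real) \<Rightarrow> 'a \<Rightarrow> 'a"
    and f :: "nat \<Rightarrow> 'w \<Rightarrow> 'a \<Rightarrow> real"
    and \<DD> :: "nat \<Rightarrow> 'w \<Rightarrow> ('a \<Rightarrow> real) measure"
    and T :: nat
  assumes horizon: "1 \<le> T"
    and domain: "X \<noteq> {}" "closed X" "convex X"
    and gradient: "gradient_operator_on X grad"
    and differentiable: "\<And>\<phi>. \<phi> \<in> space S \<Longrightarrow> \<phi> differentiable_on X"
    and eval_measurable:
      "(\<lambda>(\<phi>, x). \<phi> x) \<in> borel_measurable (S \<Otimes>\<^sub>M restrict_space borel X)"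
    and grad_measurable:
      "(\<lambda>(\<phi>, x). grad \<phi> x) \<in> borel_measurable (S \<Otimes>\<^sub>M restrict_space borel X)"
    and distr_measurable: "\<And>t. t \<in> {1..T} \<Longrightarrow> \<DD> t \<in> M \<rightarrow>\<^sub>M prob_algebra S"
    and fun_measurable: "\<And>t. t \<in> {1..T} \<Longrightarrow> f t \<in> M \<rightarrow>\<^sub>M S"
    and conditional_law: "\<And>t A. t \<in> {1..T} \<Longrightarrow> A \<in> sets S \<Longrightarrow>
      AE w in M. real_cond_exp M (past M S f \<DD> t) (\<lambda>w. indicator A (f t w)) w = measure (\<DD> t w) A"
    and exp_fun_integrable:
      "AE w in M. \<forall>t\<in>{1..T}. \<forall>x\<in>X. integrable (\<DD> t w) (\<lambda>\<phi>. \<phi> x)"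
    and exp_fun_differentiable:
      "AE w in M. \<forall>t\<in>{1..T}. exp_fun \<DD> t w differentiable_on X"
    and interchange:
      "AE w in M. \<forall>t\<in>{1..T}. \<forall>x\<in>X. integrable (\<DD> t w) (\<lambda>\<phi>. grad \<phi> x) \<and>
         grad (exp_fun \<DD> t w) x = (\<integral>\<phi>. grad \<phi> x \<partial>\<DD> t w)"
    and stoch_var_measurable:
      "\<And>t. t \<in> {1..T} \<Longrightarrow> stoch_var X grad \<DD> t \<in> borel_measurable M"
    and adv_var_measurable:
      "\<And>t. t \<in> {1..T} \<Longrightarrow> adv_var X grad \<DD> t \<in> borel_measurable M"

definition surrogate_loss ::
    "(('a \<Rightarrow> real) \<Rightarrow> 'a \<Rightarrow> 'a::euclidean_space) \<Rightarrow> real \<Rightarrow> ('a \<Rightarrow> real) \<Rightarrow> 'a \<Rightarrow> 'a \<Rightarrow> real" where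
  "surrogate_loss grad lam \<phi> z y = grad \<phi> z \<bullet> (y - z) + lam / 2 * (norm (y - z))\<^sup>2"

(* optimism grad f x t is the optimistic vector used to choose the decision of round t + 1. *)
definition optimism ::
    "(('a \<Rightarrow> real) \<Rightarrow> 'a \<Rightarrow> 'a::euclidean_space) \<Rightarrow> (nat \<Rightarrow> 'a \<Rightarrow> real) \<Rightarrow> (nat \<Rightarrow> 'a) \<Rightarrow> nat \<Rightarrow> 'a" where
  "optimism grad f x t = (if t = 0 then 0 else grad (f t) (x t))"

(* The minimizer exists and is unique for lam > 0 on a nonempty closed convex X, so this predicate
   determines x 1, ..., x T from x0 and the functions. *)
definition optimistic_ftrl ::
    "'a::euclidean_space set \<Rightarrow> (('a \<Rightarrow> real) \<Rightarrow> 'a \<Rightarrow> 'a) \<Rightarrow> real \<Rightarrow> 'a \<Rightarrow> nat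
      \<Rightarrow> (nat \<Rightarrow> 'a \<Rightarrow> real) \<Rightarrow> (nat \<Rightarrow> 'a) \<Rightarrow> bool" where
  "optimistic_ftrl X grad lam x0 T f x \<longleftrightarrow>
     (\<forall>t<T. is_arg_min
        (\<lambda>y. lam / 2 * (norm (y - x0))\<^sup>2
             + (\<Sum>s=1..t. surrogate_loss grad lam (f s) (x s) y)
             + optimism grad f x t \<bullet> y)
        (\<lambda>y. y \<in> X) (x (t + 1)))"

end

theory Submission
  imports Defs
begin

text \<open>Strong convexity of the expected functions bounds the expected regret by that of the quadratic
  surrogate losses. For the latter, the objective of round \<open>t\<close> is \<open>\<lambda>t\<close>-strongly convex, so
  following its minimizers leaves a regret of order \<open>\<parallel>g\<^sub>t - g\<^sub>t\<^sub>-\<^sub>1\<parallel>\<^sup>2 / (\<lambda>t)\<close> per round, minus a multiple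
  of \<open>\<lambda>t \<parallel>x\<^sub>t - x\<^sub>t\<^sub>-\<^sub>1\<parallel>\<^sup>2\<close>. The gradient difference splits into noise, drift of the expected gradient, and
  a smoothness term that the negative movement term absorbs except in \<open>O(L / \<lambda>)\<close> rounds. Taking
  expectations, noise and drift contribute numbers \<open>a\<^sub>t \<le> A = \<sigma>\<^sub>m\<^sub>a\<^sub>x\<^sup>2 + \<Sigma>\<^sub>m\<^sub>a\<^sub>x\<^sup>2\<close>; their partial sums \<open>V\<^sub>t\<close> are at
  most \<open>A t\<close>, so \<open>a\<^sub>t / (t + 1) \<le> a\<^sub>t / (1 + V\<^sub>t / A)\<close>, which telescopes to a logarithm.\<close>

section \<open>Quadratic objectives on \<open>X\<close> and their minimizers\<close>

text \<open>The objective of the algorithm without the optimistic hint. The gradients enter as an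
  arbitrary sequence \<open>g\<close>, so that the regret analysis is deterministic and covers every
  outcome separately.\<close>

definition ftrl_potential ::
    "real \<Rightarrow> 'a::real_inner \<Rightarrow> (nat \<Rightarrow> 'a) \<Rightarrow> (nat \<Rightarrow> 'a) \<Rightarrow> nat \<Rightarrow> 'a \<Rightarrow> real" where
  "ftrl_potential lam x0 g x t y =
     lam / 2 * (norm (y - x0))\<^sup>2 + (\<Sum>s=1..t. g s \<bullet> (y - x s) + lam / 2 * (norm (y - x s))\<^sup>2)"

text \<open>Completing the square turns the minimization into a projection of the unconstrained
  minimizer. The projection formula later yields measurability of the decisions, the quadratic
  growth around \<open>z\<close> yields the regret bound.\<close>

lemma quadratic_arg_min:
  fixes a :: "'a::euclidean_space"
  assumes X: "closed X" "convex X" and k: "k > 0"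
    and min: "is_arg_min h (\<lambda>y. y \<in> X) z"
    and h: "\<And>y. h y = k / 2 * (norm y)\<^sup>2 + a \<bullet> y + b"
  shows "z = closest_point X (- (a /\<^sub>R k))"
    and "y \<in> X \<Longrightarrow> h z + k / 2 * (norm (y - z))\<^sup>2 \<le> h y"
proof -
  define c where "c = - (a /\<^sub>R k)"
  have a: "a = - (k *\<^sub>R c)" using k by (simp add: c_def)
  have h': "h y = k / 2 * (norm (y - c))\<^sup>2 + (b - k / 2 * (norm c)\<^sup>2)" for y
    unfolding h a by (simp add: power2_norm_eq_inner inner_diff_left inner_diff_right
        inner_commute algebra_simps)
  have zX: "z \<in> X" and le: "\<And>y. y \<in> X \<Longrightarrow> h z \<le> h y"
    using min by (auto simp: is_arg_min_linorder)
  have d: "\<forall>y\<in>X. dist c z \<le> dist c y"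
  proof
    fix y assume "y \<in> X"
    from le[OF this] have "(norm (z - c))\<^sup>2 \<le> (norm (y - c))\<^sup>2"
      using k by (simp add: h')
    then have "norm (z - c) \<le> norm (y - c)"
      by (rule power2_le_imp_le) simp
    then show "dist c z \<le> dist c y"
      by (simp add: dist_norm norm_minus_commute)
  qed
  show "z = closest_point X (- (a /\<^sub>R k))"
    using closest_point_unique[OF X(2,1) zX d] by (simp add: c_def)
  assume "y \<in> X"
  \<comment> \<open>Expanding \<open>h y - h z\<close> leaves
    \<open>k / 2 * (norm (y - z))\<^sup>2\<close> and a cross term; the obtuse angle at a projection
    gives the cross term the right sign.\<close>
  from any_closest_point_dot[OF X(2,1) zX this d]
  have "k * ((c - z) \<bullet> (y - z)) \<le> 0" using k by (simp add: mult_le_0_iff)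
  then show "h z + k / 2 * (norm (y - z))\<^sup>2 \<le> h y"
    unfolding h' by (simp add: power2_norm_eq_inner inner_diff_left inner_diff_right
        inner_commute algebra_simps)
qed

lemma quadratic_arg_min_exists:
  fixes a :: "'a::euclidean_space"
  assumes X: "closed X" "X \<noteq> {}" and k: "k > 0"
    and h: "\<And>y. h y = k / 2 * (norm y)\<^sup>2 + a \<bullet> y + b"
  shows "\<exists>z. is_arg_min h (\<lambda>y. y \<in> X) z"
proof -
  define c where "c = - (a /\<^sub>R k)"
  have a: "a = - (k *\<^sub>R c)" using k by (simp add: c_def)
  have h': "h y = k / 2 * (norm (y - c))\<^sup>2 + (b - k / 2 * (norm c)\<^sup>2)" for y
    unfolding h a by (simp add: power2_norm_eq_inner inner_diff_left inner_diff_right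
        inner_commute algebra_simps)
  have "is_arg_min h (\<lambda>y. y \<in> X) (closest_point X c)"
    unfolding is_arg_min_linorder
  proof (intro conjI allI impI)
    show "closest_point X c \<in> X" using X by (rule closest_point_in_set)
    fix y assume "y \<in> X"
    from closest_point_le[OF X(1) this, of c]
    have "(norm (closest_point X c - c))\<^sup>2 \<le> (norm (y - c))\<^sup>2"
      by (simp add: dist_norm norm_minus_commute)
    then show "h (closest_point X c) \<le> h y"
      unfolding h' using k by simp
  qed
  then show ?thesis by blast
qed

text \<open>The regularizer and each of the \<open>t\<close> surrogate losses contribute curvature
  \<open>lam\<close>, hence the factor \<open>real t + 1\<close>. The constant \<open>b\<close> does
  not depend on \<open>y\<close> and so does not influence the minimizers.\<close>

lemma ftrl_potential_quadratic:
  "\<exists>b. \<forall>y. ftrl_potential lam x0 g x t y + m \<bullet> y =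
     lam * (real t + 1) / 2 * (norm y)\<^sup>2
       + ((\<Sum>s=1..t. g s - lam *\<^sub>R x s) - lam *\<^sub>R x0 + m) \<bullet> y + b"
proof (induction t)
  case 0
  show ?case
    by (rule exI[of _ "lam / 2 * (norm x0)\<^sup>2"])
      (simp add: ftrl_potential_def power2_norm_eq_inner inner_diff_left inner_diff_right
        inner_add_left inner_commute algebra_simps)
next
  case (Suc t)
  then obtain b where b: "\<And>y. ftrl_potential lam x0 g x t y + m \<bullet> y =
     lam * (real t + 1) / 2 * (norm y)\<^sup>2
       + ((\<Sum>s=1..t. g s - lam *\<^sub>R x s) - lam *\<^sub>R x0 + m) \<bullet> y + b" by blast
  have "ftrl_potential lam x0 g x (Suc t) y + m \<bullet> y =
     lam * (real (Suc t) + 1) / 2 * (norm y)\<^sup>2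
       + ((\<Sum>s=1..Suc t. g s - lam *\<^sub>R x s) - lam *\<^sub>R x0 + m) \<bullet> y
       + (b - g (Suc t) \<bullet> x (Suc t) + lam / 2 * (norm (x (Suc t)))\<^sup>2)" for y
  proof -
    have "ftrl_potential lam x0 g x (Suc t) y + m \<bullet> y =
      (ftrl_potential lam x0 g x t y + m \<bullet> y)
        + (g (Suc t) \<bullet> (y - x (Suc t)) + lam / 2 * (norm (y - x (Suc t)))\<^sup>2)"
      by (simp add: ftrl_potential_def)
    then show ?thesis
      unfolding b by (simp add: power2_norm_eq_inner inner_diff_left inner_diff_right
        inner_add_left inner_commute algebra_simps add_divide_distrib)
  qed
  then show ?case by blast
qed

lemma ftrl_arg_min:
  fixes x0 :: "'a::euclidean_space"
  assumes X: "closed X" "convex X" and lam: "lam > 0"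
    and min: "is_arg_min (\<lambda>y. ftrl_potential lam x0 g x t y + m \<bullet> y) (\<lambda>y. y \<in> X) z"
  shows "z = closest_point X (- (((\<Sum>s=1..t. g s - lam *\<^sub>R x s) - lam *\<^sub>R x0 + m)
                 /\<^sub>R (lam * (real t + 1))))"
    and "y \<in> X \<Longrightarrow> ftrl_potential lam x0 g x t z + m \<bullet> z
           + lam * (real t + 1) / 2 * (norm (y - z))\<^sup>2 \<le> ftrl_potential lam x0 g x t y + m \<bullet> y"
proof -
  obtain b where b: "\<And>y. ftrl_potential lam x0 g x t y + m \<bullet> y =
     lam * (real t + 1) / 2 * (norm y)\<^sup>2
       + ((\<Sum>s=1..t. g s - lam *\<^sub>R x s) - lam *\<^sub>R x0 + m) \<bullet> y + b"
    using ftrl_potential_quadratic by blast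
  have k: "lam * (real t + 1) > 0" using lam by simp
  note * = quadratic_arg_min[OF X k min b]
  show "z = closest_point X (- (((\<Sum>s=1..t. g s - lam *\<^sub>R x s) - lam *\<^sub>R x0 + m)
                 /\<^sub>R (lam * (real t + 1))))" by (rule *(1))
  show "y \<in> X \<Longrightarrow> ftrl_potential lam x0 g x t z + m \<bullet> z
           + lam * (real t + 1) / 2 * (norm (y - z))\<^sup>2 \<le> ftrl_potential lam x0 g x t y + m \<bullet> y"
    by (rule *(2))
qed

lemma ftrl_arg_min_exists:
  fixes x0 :: "'a::euclidean_space"
  assumes X: "closed X" "X \<noteq> {}" and lam: "lam > 0"
  shows "\<exists>z. is_arg_min (ftrl_potential lam x0 g x t) (\<lambda>y. y \<in> X) z"
proof -
  obtain b where b: "\<And>y. ftrl_potential lam x0 g x t y + 0 \<bullet> y =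
     lam * (real t + 1) / 2 * (norm y)\<^sup>2
       + ((\<Sum>s=1..t. g s - lam *\<^sub>R x s) - lam *\<^sub>R x0 + 0) \<bullet> y + b"
    using ftrl_potential_quadratic[of lam x0 g x t 0] by blast
  have k: "lam * (real t + 1) > 0" using lam by simp
  have "\<exists>z. is_arg_min (\<lambda>y. ftrl_potential lam x0 g x t y + 0 \<bullet> y) (\<lambda>y. y \<in> X) z"
    by (rule quadratic_arg_min_exists[OF X k b])
  then show ?thesis by simp
qed

section \<open>Deterministic regret in terms of noise and drift of the gradients\<close>

text \<open>The regret is compared along the minimizers \<open>z t\<close> of the potential without the hint.\<close>

lemma optimistic_ftrl_regret:
  fixes x0 :: "'a::euclidean_space"
  assumes X: "closed X" "convex X" and lam: "lam > 0" and x0: "x0 \<in> X" and u: "u \<in> X"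
    and x: "\<And>t. t < T \<Longrightarrow>
      is_arg_min (\<lambda>y. ftrl_potential lam x0 g x t y + m t \<bullet> y) (\<lambda>y. y \<in> X) (x (Suc t))"
  obtains z where
    "(\<Sum>t=1..T. g t \<bullet> (x t - u) - lam / 2 * (norm (u - x t))\<^sup>2) \<le> lam / 2 * (norm (u - x0))\<^sup>2
       + (\<Sum>t=1..T. (g t - m (t - 1)) \<bullet> (x t - z t)
            - lam * (real t + 1) / 2 * (norm (x t - z t))\<^sup>2
            - lam * real t / 2 * (norm (x t - z (t - 1)))\<^sup>2)"
proof -
  let ?W = "ftrl_potential lam x0 g x"
  have "X \<noteq> {}" using x0 by auto
  then obtain z where z: "\<And>t. is_arg_min (?W t) (\<lambda>y. y \<in> X) (z t)"
    using ftrl_arg_min_exists[OF X(1) _ lam] by metis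
  then have zX: "z t \<in> X" for t by (simp add: is_arg_min_linorder)
  have zmin: "?W t (z t) + lam * (real t + 1) / 2 * (norm (y - z t))\<^sup>2 \<le> ?W t y" if "y \<in> X" for t y
    using ftrl_arg_min(2)[OF X lam, of x0 g x t 0 "z t" y] z that by simp
  \<comment> \<open>Two growth inequalities for the potential of round \<open>t\<close> are added:
    that of \<open>x (Suc t)\<close>, tested at \<open>z (Suc t)\<close>, and that of
    \<open>z t\<close>, tested at \<open>x (Suc t)\<close>. The new surrogate loss raises the first
    curvature from \<open>Suc t\<close> to \<open>Suc t + 1\<close>, in units of
    \<open>lam / 2\<close>.\<close>
  have step: "?W t (z t) - ((g (Suc t) - m t) \<bullet> (x (Suc t) - z (Suc t))
            - lam * (real (Suc t) + 1) / 2 * (norm (x (Suc t) - z (Suc t)))\<^sup>2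
            - lam * real (Suc t) / 2 * (norm (x (Suc t) - z t))\<^sup>2)
       \<le> ?W (Suc t) (z (Suc t))" if "t < T" for t
  proof -
    have xX: "x (Suc t) \<in> X" using x[OF that] by (simp add: is_arg_min_linorder)
    have "?W (Suc t) (z (Suc t)) = ?W t (z (Suc t)) + g (Suc t) \<bullet> (z (Suc t) - x (Suc t))
        + lam / 2 * (norm (z (Suc t) - x (Suc t)))\<^sup>2"
      by (simp add: ftrl_potential_def)
    moreover note ftrl_arg_min(2)[OF X lam x[OF that] zX[of "Suc t"]] zmin[OF xX, of t]
    ultimately show ?thesis
      by (simp add: inner_diff_left inner_diff_right norm_minus_commute algebra_simps
          add_divide_distrib)
  qed
  have "?W n (z n) \<ge> - (\<Sum>t=1..n. (g t - m (t - 1)) \<bullet> (x t - z t)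
            - lam * (real t + 1) / 2 * (norm (x t - z t))\<^sup>2
            - lam * real t / 2 * (norm (x t - z (t - 1)))\<^sup>2)" if "n \<le> T" for n
    using that
  proof (induction n)
    case 0
    then show ?case using lam by (simp add: ftrl_potential_def)
  next
    case (Suc n)
    have "n < T" using Suc by simp
    with Suc step[OF this] show ?case by simp
  qed
  moreover have "0 \<le> lam * (real T + 1) / 2 * (norm (u - z T))\<^sup>2" using lam by simp
  ultimately have
    "- (\<Sum>t=1..T. (g t - m (t - 1)) \<bullet> (x t - z t)
            - lam * (real t + 1) / 2 * (norm (x t - z t))\<^sup>2
            - lam * real t / 2 * (norm (x t - z (t - 1)))\<^sup>2) \<le> ?W T u"
    using zmin[OF u, of T] by (meson add_increasing2 order.trans order_refl)
  \<comment> \<open>At \<open>u\<close> the potential is the regularizer minus the surrogate regret,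
    so a lower bound on the potential is an upper bound on the regret.\<close>
  also have "?W T u = lam / 2 * (norm (u - x0))\<^sup>2
      - (\<Sum>t=1..T. g t \<bullet> (x t - u) - lam / 2 * (norm (u - x t))\<^sup>2)"
    unfolding ftrl_potential_def
    by (simp add: inner_diff_right sum_subtractf sum.distrib algebra_simps)
  finally have "(\<Sum>t=1..T. g t \<bullet> (x t - u) - lam / 2 * (norm (u - x t))\<^sup>2) \<le> lam / 2 * (norm (u - x0))\<^sup>2
       + (\<Sum>t=1..T. (g t - m (t - 1)) \<bullet> (x t - z t)
            - lam * (real t + 1) / 2 * (norm (x t - z t))\<^sup>2
            - lam * real t / 2 * (norm (x t - z (t - 1)))\<^sup>2)" by linarith
  then show thesis by (rule that)
qed

text \<open>Young's inequality spends only \<open>k / 4\<close>, half of the curvature term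
  \<open>k / 2\<close> that the regret bound offers; the other half is kept to pay for the movement
  of the decisions.\<close>

lemma inner_young:
  fixes d b :: "'a::real_inner"
  assumes "k > 0"
  shows "d \<bullet> b - k / 4 * (norm b)\<^sup>2 \<le> (norm d)\<^sup>2 / k"
proof -
  have "0 \<le> (norm (d - (k / 2) *\<^sub>R b))\<^sup>2" by simp
  also have "\<dots> = (norm d)\<^sup>2 - k * (d \<bullet> b - k / 4 * (norm b)\<^sup>2)"
    by (simp add: power2_norm_eq_inner inner_diff_left inner_diff_right inner_commute algebra_simps)
  finally show ?thesis using assms by (simp add: field_simps)
qed

lemma norm_add_power2_le:
  fixes a b :: "'a::real_inner"
  shows "(norm (a + b))\<^sup>2 \<le> 2 * (norm a)\<^sup>2 + 2 * (norm b)\<^sup>2"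
proof -
  have "0 \<le> (norm (a - b))\<^sup>2" by simp
  then show ?thesis
    by (simp add: power2_norm_eq_inner inner_diff_left inner_diff_right inner_add_left
        inner_add_right inner_commute)
qed

text \<open>Consecutive decisions are compared through the hint-free minimizer between them: the
  curvature saved in one round and the gap to \<open>z (t - 1)\<close> in the next together dominate
  the squared step. Round one has no preceding decision and is split off.\<close>

lemma optimistic_ftrl_regret_movement:
  fixes x0 :: "'a::euclidean_space"
  assumes X: "closed X" "convex X" and lam: "lam > 0" and x0: "x0 \<in> X" and u: "u \<in> X"
    and x: "\<And>t. t < T \<Longrightarrow>
      is_arg_min (\<lambda>y. ftrl_potential lam x0 g x t y + m t \<bullet> y) (\<lambda>y. y \<in> X) (x (Suc t))"
    and T: "1 \<le> T"
  shows "(\<Sum>t=1..T. g t \<bullet> (x t - u) - lam / 2 * (norm (u - x t))\<^sup>2)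
    \<le> lam / 2 * (norm (u - x0))\<^sup>2 + (norm (g 1 - m 0))\<^sup>2 / (2 * lam)
       + (\<Sum>t=2..T. (norm (g t - m (t - 1)))\<^sup>2 / (lam * (real t + 1))
            - lam * real t / 8 * (norm (x t - x (t - 1)))\<^sup>2)"
proof -
  obtain z where z: "(\<Sum>t=1..T. g t \<bullet> (x t - u) - lam / 2 * (norm (u - x t))\<^sup>2)
     \<le> lam / 2 * (norm (u - x0))\<^sup>2
       + (\<Sum>t=1..T. (g t - m (t - 1)) \<bullet> (x t - z t)
            - lam * (real t + 1) / 2 * (norm (x t - z t))\<^sup>2
            - lam * real t / 2 * (norm (x t - z (t - 1)))\<^sup>2)"
    using optimistic_ftrl_regret[OF X lam x0 u x] by blast
  define q where "q t = (g t - m (t - 1)) \<bullet> (x t - z t)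
            - lam * (real t + 1) / 2 * (norm (x t - z t))\<^sup>2
            - lam * real t / 2 * (norm (x t - z (t - 1)))\<^sup>2" for t
  define p where "p t = lam * (real t + 1) / 4 * (norm (x t - z t))\<^sup>2" for t
  have q: "q t + p t \<le> (norm (g t - m (t - 1)))\<^sup>2 / (lam * (real t + 1))
      - lam * real t / 2 * (norm (x t - z (t - 1)))\<^sup>2" for t
    using inner_young[of "lam * (real t + 1)" "g t - m (t - 1)" "x t - z t"] lam
    by (simp add: q_def p_def)
  \<comment> \<open>The factor 1/8 makes the share of \<open>norm (x n - z n)\<close> exactly
    \<open>p n\<close>, since \<open>real (Suc n) = real n + 1\<close>.\<close>
  have move: "lam * real (Suc n) / 8 * (norm (x (Suc n) - x n))\<^sup>2
      \<le> p n + lam * real (Suc n) / 2 * (norm (x (Suc n) - z n))\<^sup>2" for n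
  proof -
    have "(norm (x (Suc n) - x n))\<^sup>2 \<le> 2 * (norm (x (Suc n) - z n))\<^sup>2 + 2 * (norm (x n - z n))\<^sup>2"
      using norm_add_power2_le[of "x (Suc n) - z n" "z n - x n"]
      by (simp add: norm_minus_commute[of "z n" "x n"])
    \<comment> \<open>Weakening 2 to 4 makes the first share match the negative term in
      \<open>q (Suc n)\<close>.\<close>
    also have "\<dots> \<le> 4 * (norm (x (Suc n) - z n))\<^sup>2 + 2 * (norm (x n - z n))\<^sup>2" by simp
    finally have "lam * real (Suc n) / 8 * (norm (x (Suc n) - x n))\<^sup>2
      \<le> lam * real (Suc n) / 8 * (4 * (norm (x (Suc n) - z n))\<^sup>2 + 2 * (norm (x n - z n))\<^sup>2)"
      using lam by (intro mult_left_mono) auto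
    also have "\<dots> = p n + lam * real (Suc n) / 2 * (norm (x (Suc n) - z n))\<^sup>2"
      by (simp add: p_def field_simps)
    finally show ?thesis .
  qed
  \<comment> \<open>The term \<open>p n\<close> on the left is the credit saved in round
    \<open>n\<close>, which the induction step spends on the movement to
    \<open>x (Suc n)\<close>.\<close>
  have "(\<Sum>t=1..n. q t) + p n \<le> (norm (g 1 - m 0))\<^sup>2 / (2 * lam)
       + (\<Sum>t=2..n. (norm (g t - m (t - 1)))\<^sup>2 / (lam * (real t + 1))
            - lam * real t / 8 * (norm (x t - x (t - 1)))\<^sup>2)" if "1 \<le> n" for n
    using that
  proof (induction n rule: dec_induct)
    case base
    have "0 \<le> lam / 2 * (norm (x 1 - z 0))\<^sup>2" using lam by simp
    with q[of 1] show ?case by (simp add: mult.commute)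
  next
    case (step n)
    then show ?case using q[of "Suc n"] move[of n] by simp
  qed
  moreover have "0 \<le> p T" using lam by (simp add: p_def)
  ultimately show ?thesis using z T unfolding q_def by fastforce
qed

text \<open>Smoothness of the expected functions only costs in the first \<open>6 L / lam\<close> rounds: later on
  the movement is paid for by the strong convexity of the accumulated losses.\<close>

lemma smoothness_term_le:
  fixes L lam r \<delta> D :: real
  assumes "lam > 0" "L > 0" "r \<ge> 2" "0 \<le> \<delta>" "\<delta> \<le> D"
  shows "4 * (L\<^sup>2 * \<delta>\<^sup>2) / (lam * (r + 1)) - lam * r / 8 * \<delta>\<^sup>2
    \<le> (if r \<le> 6 * L / lam then 4 * (L\<^sup>2 * D\<^sup>2) / (3 * lam) else 0)"
proof (cases "r \<le> 6 * L / lam")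
  case True
  have "4 * (L\<^sup>2 * \<delta>\<^sup>2) / (lam * (r + 1)) \<le> 4 * (L\<^sup>2 * D\<^sup>2) / (3 * lam)"
    using assms by (intro frac_le mult_left_mono power_mono) auto
  moreover have "0 \<le> lam * r / 8 * \<delta>\<^sup>2" using assms by simp
  ultimately show ?thesis using True by simp
next
  case False
  then have "6 * L \<le> lam * r" using assms by (simp add: field_simps)
  then have "(6 * L)\<^sup>2 \<le> (lam * r)\<^sup>2" using assms by (intro power_mono) auto
  \<comment> \<open>Clearing the factors 4 and 1/8 leaves 32, and 6 is the least integer whose
    square reaches it; this fixes the threshold \<open>6 * L / lam\<close>.\<close>
  moreover have "32 * L\<^sup>2 \<le> (6 * L)\<^sup>2" by (simp add: power_mult_distrib)
  moreover have "(lam * r)\<^sup>2 \<le> lam * r * (lam * (r + 1))"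
    using assms by (simp add: power2_eq_square algebra_simps)
  ultimately have "32 * L\<^sup>2 \<le> lam * r * (lam * (r + 1))" by linarith
  then have "32 * L\<^sup>2 / (lam * (r + 1)) \<le> lam * r" using assms by (simp add: pos_divide_le_eq)
  then have "32 * L\<^sup>2 / (lam * (r + 1)) * (\<delta>\<^sup>2 / 8) \<le> lam * r * (\<delta>\<^sup>2 / 8)"
    by (intro mult_right_mono) auto
  then show ?thesis using False by simp
qed

lemma sum_bounded_range_le:
  fixes c B :: real
  assumes "0 \<le> c" "0 \<le> B"
  shows "(\<Sum>t=2..T. if real t \<le> c then B else 0) \<le> c * B"
proof -
  have "(\<Sum>t=2..T. if real t \<le> c then B else 0) = real (card {t \<in> {2..T}. real t \<le> c}) * B"
    by (simp add: sum.If_cases Int_def)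
  also have "card {t \<in> {2..T}. real t \<le> c} \<le> card {1..nat \<lfloor>c\<rfloor>}"
    by (intro card_mono) (auto simp: le_nat_floor)
  then have "real (card {t \<in> {2..T}. real t \<le> c}) * B \<le> real (nat \<lfloor>c\<rfloor>) * B"
    using assms(2) by (intro mult_right_mono) (simp_all only: of_nat_le_iff card_atLeastAtMost diff_Suc_1)
  also have "\<dots> \<le> c * B"
    using assms by (intro mult_right_mono) auto
  finally show ?thesis .
qed

text \<open>The maps \<open>H t\<close> stand for the gradients of the expected functions. Noise
  enters each gradient difference twice, at the current and at the previous round, which doubles the
  weighted sum and turns the factor 4 into 8.\<close>

lemma optimistic_ftrl_regret_variation:
  fixes x0 :: "'a::euclidean_space" and H :: "nat \<Rightarrow> 'a \<Rightarrow> 'a"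
  assumes X: "closed X" "convex X" and pos: "lam > 0" "L > 0" and x0: "x0 \<in> X" and u: "u \<in> X"
    and bounded: "\<And>y z. y \<in> X \<Longrightarrow> z \<in> X \<Longrightarrow> norm (y - z) \<le> D"
    and x: "\<And>t. t < T \<Longrightarrow> is_arg_min
      (\<lambda>y. ftrl_potential lam x0 g x t y + (if t = 0 then 0 else g t) \<bullet> y) (\<lambda>y. y \<in> X) (x (Suc t))"
    and T: "1 \<le> T"
    and G: "norm (g 1) \<le> G"
    and smooth: "\<And>t y z. t \<in> {1..T} \<Longrightarrow> y \<in> X \<Longrightarrow> z \<in> X \<Longrightarrow> norm (H t y - H t z) \<le> L * norm (y - z)"
    and drift: "\<And>t. t \<in> {2..T} \<Longrightarrow> (norm (H t (x t) - H (t - 1) (x t)))\<^sup>2 \<le> v t"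
    and v0: "\<And>t. 0 \<le> v t"
  shows "(\<Sum>t=1..T. g t \<bullet> (x t - u) - lam / 2 * (norm (u - x t))\<^sup>2)
    \<le> lam / 2 * D\<^sup>2 + G\<^sup>2 / (2 * lam) + 8 * L ^ 3 * D\<^sup>2 / lam\<^sup>2
       + 8 / lam * (\<Sum>t=1..T. ((norm (g t - H t (x t)))\<^sup>2 + v t) / (real t + 1))"
proof -
  \<comment> \<open>The hint of round one is zero, so that round contributes only
    \<open>G\<^sup>2 / (2 * lam)\<close>.\<close>
  define m where "m t = (if t = 0 then 0 else g t)" for t
  define e where "e t = (norm (g t - H t (x t)))\<^sup>2" for t
  \<comment> \<open>Each round up to \<open>c\<close> may cost \<open>B\<close> for smoothness; the
    product \<open>c * B\<close> is the constant containing \<open>L ^ 3\<close>.\<close>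
  define c where "c = 6 * L / lam"
  define B where "B = 4 * (L\<^sup>2 * D\<^sup>2) / (3 * lam)"
  have e0: "0 \<le> e t" for t by (simp add: e_def)
  have xX: "x t \<in> X" if "t \<in> {1..T}" for t
    using x[of "t - 1"] that by (auto simp: is_arg_min_linorder)
  have step: "(norm (g t - m (t - 1)))\<^sup>2 / (lam * (real t + 1))
            - lam * real t / 8 * (norm (x t - x (t - 1)))\<^sup>2
      \<le> 4 / lam * ((e t + v t + e (t - 1)) / (real t + 1)) + (if real t \<le> c then B else 0)"
    if t: "t \<in> {2..T}" for t
  proof -
    define \<delta> where "\<delta> = norm (x t - x (t - 1))"
    have X': "x t \<in> X" "x (t - 1) \<in> X" using t by (auto intro!: xX)
    \<comment> \<open>Noise now, drift at the fixed point \<open>x t\<close>, change of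
      \<open>H (t - 1)\<close> between the two decisions, noise before. Squaring the two-term sums
      twice produces the factor 4.\<close>
    have "g t - m (t - 1) = ((g t - H t (x t)) + (H t (x t) - H (t - 1) (x t)))
        + ((H (t - 1) (x t) - H (t - 1) (x (t - 1))) + (H (t - 1) (x (t - 1)) - g (t - 1)))"
      using t by (simp add: m_def)
    then have "(norm (g t - m (t - 1)))\<^sup>2
        \<le> 2 * (norm ((g t - H t (x t)) + (H t (x t) - H (t - 1) (x t))))\<^sup>2
        + 2 * (norm ((H (t - 1) (x t) - H (t - 1) (x (t - 1))) + (H (t - 1) (x (t - 1)) - g (t - 1))))\<^sup>2"
      by (simp only: norm_add_power2_le)
    also have "\<dots> \<le> 2 * (2 * (norm (g t - H t (x t)))\<^sup>2 + 2 * (norm (H t (x t) - H (t - 1) (x t)))\<^sup>2)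
      + 2 * (2 * (norm (H (t - 1) (x t) - H (t - 1) (x (t - 1))))\<^sup>2
             + 2 * (norm (H (t - 1) (x (t - 1)) - g (t - 1)))\<^sup>2)"
      by (intro add_mono mult_left_mono norm_add_power2_le) auto
    also have "\<dots> \<le> 2 * (2 * e t + 2 * v t) + 2 * (2 * (L\<^sup>2 * \<delta>\<^sup>2) + 2 * e (t - 1))"
    proof (intro add_mono mult_left_mono)
      have "norm (H (t - 1) (x t) - H (t - 1) (x (t - 1))) \<le> L * \<delta>"
        unfolding \<delta>_def using t X' by (intro smooth) auto
      then have "(norm (H (t - 1) (x t) - H (t - 1) (x (t - 1))))\<^sup>2 \<le> (L * \<delta>)\<^sup>2"
        by (intro power_mono) auto
      then show "(norm (H (t - 1) (x t) - H (t - 1) (x (t - 1))))\<^sup>2 \<le> L\<^sup>2 * \<delta>\<^sup>2"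
        by (simp add: power_mult_distrib)
    qed (use drift[OF t] in \<open>auto simp: e_def norm_minus_commute\<close>)
    finally have "(norm (g t - m (t - 1)))\<^sup>2 \<le> 4 * (e t + v t + e (t - 1)) + 4 * (L\<^sup>2 * \<delta>\<^sup>2)"
      by simp
    then have "(norm (g t - m (t - 1)))\<^sup>2 / (lam * (real t + 1))
      \<le> (4 * (e t + v t + e (t - 1)) + 4 * (L\<^sup>2 * \<delta>\<^sup>2)) / (lam * (real t + 1))"
      using pos by (intro divide_right_mono) auto
    also have "\<dots> = 4 / lam * ((e t + v t + e (t - 1)) / (real t + 1))
        + 4 * (L\<^sup>2 * \<delta>\<^sup>2) / (lam * (real t + 1))"
      by (simp add: add_divide_distrib mult.commute[of lam])
    moreover have "4 * (L\<^sup>2 * \<delta>\<^sup>2) / (lam * (real t + 1)) - lam * real t / 8 * \<delta>\<^sup>2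
        \<le> (if real t \<le> c then B else 0)"
      unfolding c_def B_def
      using pos t bounded[OF X'] by (intro smoothness_term_le) (auto simp: \<delta>_def)
    ultimately show ?thesis unfolding \<delta>_def by linarith
  qed
  \<comment> \<open>Shifting the index replaces \<open>e (t - 1)\<close> by \<open>e s\<close> with
    the larger denominator \<open>real s + 2\<close>, so the noise of the previous round obeys the
    same bound.\<close>
  have prev: "(\<Sum>t=2..T. e (t - 1) / (real t + 1)) \<le> (\<Sum>t=1..T. e t / (real t + 1))"
  proof -
    have "(\<Sum>t=2..T. e (t - 1) / (real t + 1)) = (\<Sum>s=1..T - 1. e s / (real (Suc s) + 1))"
      by (rule sum.reindex_bij_witness[of _ Suc "\<lambda>t. t - 1"]) auto
    also have "\<dots> \<le> (\<Sum>s=1..T - 1. e s / (real s + 1))"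
      using e0 by (intro sum_mono divide_left_mono) auto
    also have "\<dots> \<le> (\<Sum>t=1..T. e t / (real t + 1))"
      using e0 by (intro sum_mono2) auto
    finally show ?thesis .
  qed
  have cur: "(\<Sum>t=2..T. (e t + v t) / (real t + 1)) \<le> (\<Sum>t=1..T. (e t + v t) / (real t + 1))"
    using e0 v0 by (intro sum_mono2) auto
  have "(\<Sum>t=1..T. e t / (real t + 1)) \<le> (\<Sum>t=1..T. (e t + v t) / (real t + 1))"
    using v0 by (intro sum_mono divide_right_mono) auto
  with prev cur have noise: "(\<Sum>t=2..T. (e t + v t + e (t - 1)) / (real t + 1))
      \<le> 2 * (\<Sum>t=1..T. (e t + v t) / (real t + 1))"
    by (simp add: add_divide_distrib sum.distrib)
  have "(\<Sum>t=1..T. g t \<bullet> (x t - u) - lam / 2 * (norm (u - x t))\<^sup>2)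
    \<le> lam / 2 * (norm (u - x0))\<^sup>2 + (norm (g 1 - m 0))\<^sup>2 / (2 * lam)
       + (\<Sum>t=2..T. (norm (g t - m (t - 1)))\<^sup>2 / (lam * (real t + 1))
            - lam * real t / 8 * (norm (x t - x (t - 1)))\<^sup>2)"
    using x by (intro optimistic_ftrl_regret_movement[OF X pos(1) x0 u _ T]) (simp add: m_def)
  also have "\<dots> \<le> lam / 2 * D\<^sup>2 + G\<^sup>2 / (2 * lam)
      + (\<Sum>t=2..T. 4 / lam * ((e t + v t + e (t - 1)) / (real t + 1)) + (if real t \<le> c then B else 0))"
    using pos G bounded[OF u x0]
    by (intro add_mono mult_left_mono divide_right_mono power_mono sum_mono step) (auto simp: m_def)
  also have "(\<Sum>t=2..T. 4 / lam * ((e t + v t + e (t - 1)) / (real t + 1)) + (if real t \<le> c then B else 0))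
      = 4 / lam * (\<Sum>t=2..T. (e t + v t + e (t - 1)) / (real t + 1))
        + (\<Sum>t=2..T. if real t \<le> c then B else 0)"
    by (simp only: sum.distrib sum_distrib_left)
  also have "\<dots> \<le> 4 / lam * (2 * (\<Sum>t=1..T. (e t + v t) / (real t + 1))) + c * B"
    using pos by (intro add_mono mult_left_mono noise sum_bounded_range_le) (auto simp: c_def B_def)
  also have "c * B = 8 * L ^ 3 * D\<^sup>2 / lam\<^sup>2"
    by (simp add: c_def B_def power2_eq_square power3_eq_cube)
  finally show ?thesis by (simp add: e_def)
qed

section \<open>Two analytic tools: a logarithmic sum bound and the gradient form of strong
  convexity\<close>

lemma sum_weighted_le_ln:
  fixes a :: "nat \<Rightarrow> real"
  assumes A: "A > 0" and a: "\<And>t. t \<in> {1..n} \<Longrightarrow> 0 \<le> a t \<and> a t \<le> A"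
  shows "(\<Sum>t=1..n. a t / (real t + 1)) \<le> A * ln (1 + (\<Sum>t=1..n. a t) / A)"
  using a
proof (induction n)
  case 0
  then show ?case by simp
next
  case (Suc n)
  define V where "V = (\<Sum>t=1..n. a t)"
  define b where "b = a (Suc n)"
  have b: "0 \<le> b" "b \<le> A" using Suc.prems[of "Suc n"] by (auto simp: b_def)
  have V0: "V \<ge> 0" unfolding V_def by (rule sum_nonneg) (use Suc.prems in auto)
  have "V \<le> (\<Sum>t=1..n. A)" unfolding V_def by (rule sum_mono) (use Suc.prems in auto)
  then have V: "V \<le> real n * A" by simp
  have p: "A + V > 0" "A + V + b > 0" using A V0 b by auto
  have "b / (real (Suc n) + 1) \<le> A * (b / (A + V + b))"
  proof -
    \<comment> \<open>The \<open>n\<close> earlier terms, the new term \<open>b\<close> and the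
      offset \<open>A\<close> are each at most \<open>A\<close>, which accounts for
      \<open>n + 2\<close> copies.\<close>
    have "A + V + b \<le> A * (real (Suc n) + 1)" using V b by (simp add: algebra_simps)
    then have "b * (A + V + b) \<le> b * (A * (real (Suc n) + 1))" using b by (intro mult_left_mono)
    then show ?thesis using p(2) by (simp add: field_simps)
  qed
  also have "b / (A + V + b) \<le> ln ((A + V + b) / (A + V))"
  proof -
    \<comment> \<open>Applying \<open>ln r \<le> r - 1\<close> to the reciprocal ratio bounds the
      relative increment by the increment of the logarithm.\<close>
    have "ln ((A + V) / (A + V + b)) \<le> (A + V) / (A + V + b) - 1"
      using p by (intro ln_le_minus_one) simp
    also have "\<dots> = - (b / (A + V + b))" using p by (simp add: field_simps)
    finally show ?thesis using p by (simp add: ln_div)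
  qed
  also have "(A + V + b) / (A + V) = (1 + (V + b) / A) / (1 + V / A)"
  proof -
    have "1 + (V + b) / A = (A + V + b) / A" "1 + V / A = (A + V) / A"
      using A by (simp_all add: add_divide_distrib)
    then show ?thesis using A by simp
  qed
  also have "ln \<dots> = ln (1 + (V + b) / A) - ln (1 + V / A)"
  proof -
    have "0 < 1 + (V + b) / A" "0 < 1 + V / A"
      using A V0 b by (auto intro!: add_pos_nonneg divide_nonneg_nonneg)
    then show ?thesis by (simp add: ln_div)
  qed
  finally have "b / (real (Suc n) + 1) \<le> A * (ln (1 + (V + b) / A) - ln (1 + V / A))"
    using A by simp
  moreover have "(\<Sum>t=1..n. a t / (real t + 1)) \<le> A * ln (1 + V / A)"
    unfolding V_def using Suc by simp
  ultimately show ?case by (simp add: V_def b_def algebra_simps)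
qed

text \<open>Along the segment from \<open>z\<close> to \<open>u\<close>, the strong convexity
  inequality is divided by the parameter, which then tends to 0 from the right. Working within the
  segment uses only the derivative relative to \<open>X\<close>, whose interior may be
  empty.\<close>

lemma strongly_convex_on_gradient:
  fixes \<phi> :: "'a::euclidean_space \<Rightarrow> real"
  assumes sc: "strongly_convex_on X lam \<phi>" and X: "convex X" and z: "z \<in> X" and u: "u \<in> X"
    and d: "(\<phi> has_derivative (\<lambda>h. v \<bullet> h)) (at z within X)"
  shows "\<phi> z + v \<bullet> (u - z) + lam / 2 * (norm (u - z))\<^sup>2 \<le> \<phi> u"
proof -
  define p where "p \<theta> = z + \<theta> *\<^sub>R (u - z)" for \<theta> :: real
  have pX: "p \<theta> \<in> X" if "\<theta> \<in> {0..1}" for \<theta>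
    using convexD_alt[OF X z u, of \<theta>] that by (simp add: p_def algebra_simps)
  have "(p has_derivative (\<lambda>\<theta>. \<theta> *\<^sub>R (u - z))) (at 0 within {0..1})"
    unfolding p_def by (auto intro!: derivative_eq_intros)
  moreover have "(\<phi> has_derivative (\<lambda>h. v \<bullet> h)) (at (p 0) within p ` {0..1})"
    using d pX by (auto simp: p_def intro: has_derivative_subset)
  ultimately have "(\<phi> \<circ> p has_derivative (\<lambda>h. v \<bullet> h) \<circ> (\<lambda>\<theta>. \<theta> *\<^sub>R (u - z))) (at 0 within {0..1})"
    by (rule diff_chain_within)
  then have "((\<lambda>\<theta>. \<phi> (p \<theta>)) has_real_derivative v \<bullet> (u - z)) (at 0 within {0..1})"
    unfolding has_field_derivative_def by (simp add: o_def mult.commute[of _ "v \<bullet> (u - z)"])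
  then have lim: "((\<lambda>\<theta>. (\<phi> (p \<theta>) - \<phi> z) / \<theta>) \<longlongrightarrow> v \<bullet> (u - z)) (at 0 within {0..1})"
    unfolding has_field_derivative_iff by (simp add: p_def)
  have lim': "((\<lambda>\<theta>. \<phi> u - \<phi> z - lam / 2 * (1 - \<theta>) * (norm (u - z))\<^sup>2) \<longlongrightarrow>
      \<phi> u - \<phi> z - lam / 2 * (1 - 0) * (norm (u - z))\<^sup>2) (at (0::real) within {0..1})"
    by (intro tendsto_intros)
  have ev: "\<forall>\<^sub>F \<theta> in at (0::real) within {0..1}.
      (\<phi> (p \<theta>) - \<phi> z) / \<theta> \<le> \<phi> u - \<phi> z - lam / 2 * (1 - \<theta>) * (norm (u - z))\<^sup>2"
    unfolding eventually_at_filter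
  proof (intro always_eventually allI impI)
    fix \<theta> :: real assume \<theta>: "\<theta> \<noteq> 0" "\<theta> \<in> {0..1}"
    have "\<theta> *\<^sub>R u + (1 - \<theta>) *\<^sub>R z = p \<theta>" by (simp add: p_def algebra_simps)
    then have "\<phi> (p \<theta>) \<le> \<theta> * \<phi> u + (1 - \<theta>) * \<phi> z - lam / 2 * \<theta> * (1 - \<theta>) * (norm (u - z))\<^sup>2"
      using sc u z \<theta> unfolding strongly_convex_on_def by metis
    then have "\<phi> (p \<theta>) - \<phi> z \<le> (\<phi> u - \<phi> z - lam / 2 * (1 - \<theta>) * (norm (u - z))\<^sup>2) * \<theta>"
      by (simp add: algebra_simps)
    then show "(\<phi> (p \<theta>) - \<phi> z) / \<theta> \<le> \<phi> u - \<phi> z - lam / 2 * (1 - \<theta>) * (norm (u - z))\<^sup>2"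
      using \<theta> by (subst pos_divide_le_eq) auto
  qed
  have "at (0::real) within {0..1} \<noteq> bot"
    by (simp add: trivial_limit_within islimpt_Icc)
  from tendsto_le[OF this lim' lim ev] show ?thesis by simp
qed

section \<open>Conditioning on the past\<close>

context sea_model
begin

lemma sets_past:
  assumes "t \<le> T"
  shows "sets (past M S f \<DD> t) = sigma_sets (space M)
     ((\<Union>s\<in>{1..<t}. {f s -` A \<inter> space M |A. A \<in> sets S}) \<union>
      (\<Union>s\<in>{1..t}. {\<DD> s -` B \<inter> space M |B. B \<in> sets (prob_algebra S)}))"
  unfolding past_def by (rule sets_measure_of) auto

lemma space_past [simp]: "space (past M S f \<DD> t) = space M"
  unfolding past_def by (rule space_measure_of) auto

lemma subalgebra_past:
  assumes "t \<le> T"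
  shows "subalgebra M (past M S f \<DD> t)"
proof -
  have "f s -` A \<inter> space M \<in> sets M" if "s \<in> {1..<t}" "A \<in> sets S" for s A
    using fun_measurable[of s] that assms by (auto intro: measurable_sets)
  moreover have "\<DD> s -` B \<inter> space M \<in> sets M" if "s \<in> {1..t}" "B \<in> sets (prob_algebra S)" for s B
    using distr_measurable[of s] that assms by (auto intro: measurable_sets)
  ultimately show ?thesis
    unfolding subalgebra_def sets_past[OF assms]
    by (auto intro!: sets.sigma_sets_subset)
qed

lemma fun_measurable_past:
  assumes "s \<in> {1..<t}" "t \<le> T"
  shows "f s \<in> past M S f \<DD> t \<rightarrow>\<^sub>M S"
proof (rule measurableI)
  have *: "f s \<in> M \<rightarrow>\<^sub>M S" using assms by (intro fun_measurable) auto
  show "f s w \<in> space S" if "w \<in> space (past M S f \<DD> t)" for w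
    using measurable_space[OF *] that by simp
  show "f s -` A \<inter> space (past M S f \<DD> t) \<in> sets (past M S f \<DD> t)" if "A \<in> sets S" for A
    unfolding space_past sets_past[OF assms(2)]
    using assms(1) that by (intro sigma_sets.Basic UnI1 UN_I[of s]) auto
qed

lemma distr_measurable_past:
  assumes "t \<in> {1..T}"
  shows "\<DD> t \<in> past M S f \<DD> t \<rightarrow>\<^sub>M prob_algebra S"
proof (rule measurableI)
  show "\<DD> t w \<in> space (prob_algebra S)" if "w \<in> space (past M S f \<DD> t)" for w
    using measurable_space[OF distr_measurable[OF assms]] that by simp
  show "\<DD> t -` A \<inter> space (past M S f \<DD> t) \<in> sets (past M S f \<DD> t)"
    if "A \<in> sets (prob_algebra S)" for A
  proof -
    have tT: "t \<le> T" using assms by simp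
    show ?thesis
      unfolding space_past sets_past[OF tT]
      using assms that by (intro sigma_sets.Basic UnI2 UN_I[of t]) auto
  qed
qed

lemma distr_measurable_subprob: "t \<in> {1..T} \<Longrightarrow> \<DD> t \<in> M \<rightarrow>\<^sub>M subprob_algebra S"
  using distr_measurable by (rule measurable_prob_algebraD)

lemma sets_distr: "t \<in> {1..T} \<Longrightarrow> w \<in> space M \<Longrightarrow> sets (\<DD> t w) = sets S"
  using measurable_space[OF distr_measurable] by (auto simp: space_prob_algebra)

lemma prob_space_distr_round: "t \<in> {1..T} \<Longrightarrow> w \<in> space M \<Longrightarrow> prob_space (\<DD> t w)"
  using measurable_space[OF distr_measurable] by (auto simp: space_prob_algebra)

text \<open>The event on \<open>Z\<close> is known to the past, so its indicator can be moved into
  the conditional expectation of the event on \<open>f t\<close>, which is then the conditional law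
  of \<open>A\<close>.\<close>

lemma emeasure_conditional_law:
  assumes t: "t \<in> {1..T}" and Z: "Z \<in> past M S f \<DD> t \<rightarrow>\<^sub>M N"
    and A: "A \<in> sets S" and B: "B \<in> sets N"
  shows "emeasure M {w \<in> space M. f t w \<in> A \<and> Z w \<in> B}
    = (\<integral>\<^sup>+w. indicator B (Z w) * emeasure (\<DD> t w) A \<partial>M)"
proof -
  let ?F = "past M S f \<DD> t"
  have sub: "subalgebra M ?F" using t by (intro subalgebra_past) auto
  interpret F: finite_measure_subalgebra M ?F by unfold_locales (rule sub)
  note [measurable] = fun_measurable[OF t] A B measurable_from_subalg[OF sub Z] Z
    distr_measurable_subprob[OF t]
  have int: "integrable M (\<lambda>w. indicator B (Z w) * indicator A (f t w) :: real)"
    by (rule integrable_const_bound[where B = 1]) (auto simp: indicator_def)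
  have i1: "(\<lambda>w. indicator B (Z w) :: real) \<in> borel_measurable ?F" by measurable
  have i2: "(\<lambda>w. indicator A (f t w) :: real) \<in> borel_measurable M" by measurable
  note ce = F.real_cond_exp_intg[OF int i1 i2]
  have "{w \<in> space M. f t w \<in> A \<and> Z w \<in> B} \<in> sets M" by measurable
  then have "emeasure M {w \<in> space M. f t w \<in> A \<and> Z w \<in> B}
      = ennreal (\<integral>w. indicator {w \<in> space M. f t w \<in> A \<and> Z w \<in> B} w \<partial>M)"
    by (simp add: emeasure_eq_measure)
  also have "(\<integral>w. indicator {w \<in> space M. f t w \<in> A \<and> Z w \<in> B} w \<partial>M)
      = (\<integral>w. indicator B (Z w) * indicator A (f t w) \<partial>M :: real)"
    by (intro Bochner_Integration.integral_cong) (auto simp: indicator_def)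
  also have "\<dots> = (\<integral>w. indicator B (Z w) * real_cond_exp M ?F (\<lambda>w. indicator A (f t w)) w \<partial>M)"
    using ce(2) by simp
  also have "\<dots> = (\<integral>w. indicator B (Z w) * measure (\<DD> t w) A \<partial>M)"
    using conditional_law[OF t A] by (intro integral_cong_AE) auto
  also have "ennreal \<dots> = (\<integral>\<^sup>+w. ennreal (indicator B (Z w) * measure (\<DD> t w) A) \<partial>M)"
    using prob_space.prob_le_1[OF prob_space_distr_round[OF t]]
    by (intro nn_integral_eq_integral[symmetric] integrable_const_bound[where B = 1])
      (auto simp: indicator_def intro!: AE_I2)
  also have "\<dots> = (\<integral>\<^sup>+w. indicator B (Z w) * emeasure (\<DD> t w) A \<partial>M)"
  proof (rule nn_integral_cong)
    fix w assume "w \<in> space M"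
    then interpret D: prob_space "\<DD> t w" by (rule prob_space_distr_round[OF t])
    show "ennreal (indicator B (Z w) * measure (\<DD> t w) A) = indicator B (Z w) * emeasure (\<DD> t w) A"
      by (simp add: D.emeasure_eq_measure indicator_def)
  qed
  finally show ?thesis .
qed

text \<open>Disintegration of the joint law of \<open>f t\<close> and a quantity \<open>Z\<close>
  known beforehand. Agreement on rectangles extends to the product sigma-algebra by intersection
  stability, so the null sets, which depend on the event \<open>A\<close>, need not be
  combined.\<close>

lemma nn_integral_conditional_law:
  assumes t: "t \<in> {1..T}" and Z: "Z \<in> past M S f \<DD> t \<rightarrow>\<^sub>M N"
    and h: "h \<in> borel_measurable (S \<Otimes>\<^sub>M N)"
  shows "(\<integral>\<^sup>+w. h (f t w, Z w) \<partial>M) = (\<integral>\<^sup>+w. \<integral>\<^sup>+\<phi>. h (\<phi>, Z w) \<partial>\<DD> t w \<partial>M)"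
proof -
  have sub: "subalgebra M (past M S f \<DD> t)" using t by (intro subalgebra_past) auto
  note ZM = measurable_from_subalg[OF sub Z]
  note [measurable] = fun_measurable[OF t] ZM distr_measurable_subprob[OF t] h
  \<comment> \<open>The law of the pair when \<open>Z\<close> is frozen at its value at
    \<open>w\<close> and only the function is drawn.\<close>
  define K where "K w = distr (\<DD> t w) (S \<Otimes>\<^sub>M N) (\<lambda>\<phi>. (\<phi>, Z w))" for w
  define P where "P = distr M (S \<Otimes>\<^sub>M N) (\<lambda>w. (f t w, Z w))"
  have K: "K \<in> M \<rightarrow>\<^sub>M subprob_algebra (S \<Otimes>\<^sub>M N)"
    unfolding K_def by (rule measurable_distr2[where M = S]) measurable
  have Km: "(\<lambda>\<phi>. (\<phi>, Z w)) \<in> \<DD> t w \<rightarrow>\<^sub>M S \<Otimes>\<^sub>M N" if "w \<in> space M" for w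
    using measurable_space[OF ZM that] by (subst measurable_cong_sets[OF sets_distr[OF t that] refl]) simp
  have "P = M \<bind> K"
  proof (rule measure_eqI_generator_eq)
    let ?E = "{A \<times> B |A B. A \<in> sets S \<and> B \<in> sets N}"
    show "Int_stable ?E" by (rule Int_stable_pair_measure_generator)
    show "?E \<subseteq> Pow (space S \<times> space N)" by (rule pair_measure_closed)
    show "sets P = sigma_sets (space S \<times> space N) ?E"
      by (simp add: P_def sets_pair_measure)
    have "sets (M \<bind> K) = sets (S \<Otimes>\<^sub>M N)"
      by (rule sets_bind[OF _ not_empty]) (simp add: K_def)
    then show "sets (M \<bind> K) = sigma_sets (space S \<times> space N) ?E"
      by (simp add: sets_pair_measure)
    show "range (\<lambda>_::nat. space S \<times> space N) \<subseteq> ?E" by auto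
    show "(\<Union>i::nat. space S \<times> space N) = space S \<times> space N" by simp
    have "prob_space P" unfolding P_def by (rule prob_space_distr) measurable
    then interpret P: prob_space P .
    show "emeasure P (space S \<times> space N) \<noteq> \<infinity>" for i :: nat by simp
    fix C assume "C \<in> ?E"
    then obtain A B where C: "C = A \<times> B" and [measurable]: "A \<in> sets S" "B \<in> sets N" by auto
    have "emeasure P C = emeasure M {w \<in> space M. f t w \<in> A \<and> Z w \<in> B}"
      unfolding C P_def by (subst emeasure_distr) (auto intro!: arg_cong[where f = "emeasure M"])
    also have "\<dots> = (\<integral>\<^sup>+w. indicator B (Z w) * emeasure (\<DD> t w) A \<partial>M)"
      by (rule emeasure_conditional_law[OF t Z]) fact+
    also have "\<dots> = (\<integral>\<^sup>+w. emeasure (K w) C \<partial>M)"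
    proof (rule nn_integral_cong)
      fix w assume w: "w \<in> space M"
      have "(\<lambda>\<phi>. (\<phi>, Z w)) -` (A \<times> B) \<inter> space (\<DD> t w) = (if Z w \<in> B then A else {})"
        using sets_eq_imp_space_eq[OF sets_distr[OF t w]] sets.sets_into_space[OF \<open>A \<in> sets S\<close>] by auto
      then show "indicator B (Z w) * emeasure (\<DD> t w) A = emeasure (K w) C"
        unfolding C K_def by (subst emeasure_distr[OF Km[OF w]]) (auto simp: indicator_def)
    qed
    also have "\<dots> = emeasure (M \<bind> K) C"
      unfolding C by (subst emeasure_bind[OF not_empty K]) auto
    finally show "emeasure P C = emeasure (M \<bind> K) C" .
  qed
  then have "(\<integral>\<^sup>+p. h p \<partial>P) = (\<integral>\<^sup>+w. \<integral>\<^sup>+p. h p \<partial>K w \<partial>M)"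
    by (simp add: nn_integral_bind[OF h K])
  also have "\<dots> = (\<integral>\<^sup>+w. \<integral>\<^sup>+\<phi>. h (\<phi>, Z w) \<partial>\<DD> t w \<partial>M)"
    unfolding K_def by (intro nn_integral_cong nn_integral_distr[OF Km]) (simp_all add: h)
  finally show ?thesis
    unfolding P_def by (simp add: nn_integral_distr)
qed

text \<open>The bound on \<open>h\<close> is given only along the drawn functions, whereas the tower
  property is available for nonnegative integrands. Adding \<open>K\<close> makes \<open>h\<close>
  nonnegative along the draws, and the tower property itself carries this over to almost every
  function under \<open>\<DD> t w\<close>.\<close>

lemma integral_conditional_law_nonpos:
  fixes h :: "('a \<Rightarrow> real) \<times> 'n \<Rightarrow> real"
  assumes t: "t \<in> {1..T}" and Z: "Z \<in> past M S f \<DD> t \<rightarrow>\<^sub>M N"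
    and h: "h \<in> borel_measurable (S \<Otimes>\<^sub>M N)"
    and bound: "AE w in M. \<bar>h (f t w, Z w)\<bar> \<le> K"
    and int: "AE w in M. integrable (\<DD> t w) (\<lambda>\<phi>. h (\<phi>, Z w)) \<and> (\<integral>\<phi>. h (\<phi>, Z w) \<partial>\<DD> t w) \<le> 0"
  shows "(\<integral>w. h (f t w, Z w) \<partial>M) \<le> 0"
proof -
  have sub: "subalgebra M (past M S f \<DD> t)" using t by (intro subalgebra_past) auto
  note [measurable] = fun_measurable[OF t] measurable_from_subalg[OF sub Z] h
  have i: "integrable M (\<lambda>w. h (f t w, Z w))"
    using bound by (intro integrable_const_bound[where B = K]) auto
  \<comment> \<open>The integrand is the negative part of \<open>h + K\<close>; its integral along
    the draws vanishes, hence so does its inner integral for almost every \<open>w\<close>.\<close>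
  have "(\<integral>\<^sup>+w. \<integral>\<^sup>+\<phi>. ennreal (- (h (\<phi>, Z w) + K)) \<partial>\<DD> t w \<partial>M) =
      (\<integral>\<^sup>+w. ennreal (- (h (f t w, Z w) + K)) \<partial>M)"
    by (rule nn_integral_conditional_law[OF t Z, symmetric]) measurable
  also have "\<dots> = 0"
    using bound by (intro nn_integral_zero' ) (auto simp: ennreal_eq_0_iff)
  finally have "AE w in M. (\<integral>\<^sup>+\<phi>. ennreal (- (h (\<phi>, Z w) + K)) \<partial>\<DD> t w) = 0"
  proof (subst (asm) nn_integral_0_iff_AE)
    have "(\<lambda>(w, \<phi>). ennreal (- (h (\<phi>, Z w) + K))) \<in> borel_measurable (M \<Otimes>\<^sub>M S)" by measurable
    from nn_integral_measurable_subprob_algebra2[OF this distr_measurable_subprob[OF t]]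
    show "(\<lambda>w. \<integral>\<^sup>+\<phi>. ennreal (- (h (\<phi>, Z w) + K)) \<partial>\<DD> t w) \<in> borel_measurable M" .
  qed
  then have le: "AE w in M. (\<integral>\<^sup>+\<phi>. ennreal (h (\<phi>, Z w) + K) \<partial>\<DD> t w) \<le> ennreal K"
    using int AE_space
  proof eventually_elim
    case (elim w)
    interpret D: prob_space "\<DD> t w" by (rule prob_space_distr_round[OF t]) (use elim in auto)
    have m: "(\<lambda>\<phi>. h (\<phi>, Z w)) \<in> borel_measurable (\<DD> t w)"
      using elim(2) by auto
    have "AE \<phi> in \<DD> t w. 0 \<le> h (\<phi>, Z w) + K"
      using elim(1) m by (subst (asm) nn_integral_0_iff_AE) (auto simp: ennreal_eq_0_iff)
    then have "(\<integral>\<^sup>+\<phi>. ennreal (h (\<phi>, Z w) + K) \<partial>\<DD> t w) = ennreal (\<integral>\<phi>. h (\<phi>, Z w) + K \<partial>\<DD> t w)"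
      using elim by (intro nn_integral_eq_integral) auto
    also have "(\<integral>\<phi>. h (\<phi>, Z w) + K \<partial>\<DD> t w) \<le> K"
      using elim by (simp add: D.prob_space)
    finally show ?case by (simp add: ennreal_leI)
  qed
  have K: "K \<ge> 0"
  proof -
    from bound have "AE w in M. 0 \<le> K" by eventually_elim auto
    then show ?thesis by simp
  qed
  have "ennreal (\<integral>w. h (f t w, Z w) + K \<partial>M) = (\<integral>\<^sup>+w. ennreal (h (f t w, Z w) + K) \<partial>M)"
    using bound i by (intro nn_integral_eq_integral[symmetric]) auto
  also have "\<dots> = (\<integral>\<^sup>+w. \<integral>\<^sup>+\<phi>. ennreal (h (\<phi>, Z w) + K) \<partial>\<DD> t w \<partial>M)"
    by (rule nn_integral_conditional_law[OF t Z]) measurable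
  also have "\<dots> \<le> (\<integral>\<^sup>+w. ennreal K \<partial>M)"
    using le by (rule nn_integral_mono_AE)
  also have "\<dots> = ennreal K" by (simp add: emeasure_space_1)
  finally have "(\<integral>w. h (f t w, Z w) + K \<partial>M) \<le> K"
    using K by simp
  then show "(\<integral>w. h (f t w, Z w) \<partial>M) \<le> 0" using i by (simp add: prob_space)
qed

end

text \<open>Pairing the kernel with a point mass at \<open>w\<close> turns an integrand that varies
  with \<open>w\<close> into a fixed one on the product space.\<close>

lemma integral_measurable_subprob_algebra2:
  fixes h :: "'b \<times> 'c \<Rightarrow> 'd::{banach, second_countable_topology}"
  assumes h[measurable]: "h \<in> borel_measurable (P \<Otimes>\<^sub>M N)"
    and L[measurable]: "L \<in> P \<rightarrow>\<^sub>M subprob_algebra N"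
  shows "(\<lambda>w. \<integral>y. h (w, y) \<partial>L w) \<in> borel_measurable P"
proof -
  have "(\<lambda>w. distr (L w) (P \<Otimes>\<^sub>M N) (\<lambda>y. (w, y))) \<in> P \<rightarrow>\<^sub>M subprob_algebra (P \<Otimes>\<^sub>M N)"
    by (rule measurable_distr2[where M = N]) measurable
  from measurable_compose[OF this integral_measurable_subprob_algebra[OF h]]
  show ?thesis
    by (rule measurable_cong[THEN iffD1, rotated]) (simp add: integral_distr)
qed

lemma optimistic_ftrl_arg_min:
  assumes "optimistic_ftrl X grad lam x0 T f x" "t < T"
  shows "is_arg_min (\<lambda>y. ftrl_potential lam x0 (\<lambda>s. grad (f s) (x s)) x t y
      + (if t = 0 then 0 else grad (f t) (x t)) \<bullet> y) (\<lambda>y. y \<in> X) (x (Suc t))"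
  using assms
  unfolding optimistic_ftrl_def ftrl_potential_def surrogate_loss_def optimism_def by simp

text \<open>Mean value inequality on the convex domain. Function values themselves carry no bound;
  this controls their differences, which makes the regret integrable.\<close>

lemma lipschitz_of_gradient_bound:
  fixes \<phi> :: "'a::euclidean_space \<Rightarrow> real"
  assumes grad: "gradient_operator_on X grad" and X: "convex X" and \<phi>: "\<phi> differentiable_on X"
    and G: "\<And>y. y \<in> X \<Longrightarrow> norm (grad \<phi> y) \<le> G" and yz: "y \<in> X" "z \<in> X"
  shows "\<bar>\<phi> y - \<phi> z\<bar> \<le> G * norm (y - z)"
proof -
  have "onorm (\<lambda>h. grad \<phi> y \<bullet> h) \<le> G" if "y \<in> X" for y
  proof (rule onorm_le)
    fix h
    have "\<bar>grad \<phi> y \<bullet> h\<bar> \<le> norm (grad \<phi> y) * norm h" by (rule Cauchy_Schwarz_ineq2)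
    also have "\<dots> \<le> G * norm h" using G[OF that] by (rule mult_right_mono) simp
    finally show "norm (grad \<phi> y \<bullet> h) \<le> G * norm h" by simp
  qed
  then have "norm (\<phi> y - \<phi> z) \<le> G * norm (y - z)"
    using grad \<phi> yz
    by (intro differentiable_bound[OF X, of \<phi> "\<lambda>y h. grad \<phi> y \<bullet> h"])
      (auto simp: gradient_operator_on_def differentiable_on_def)
  then show ?thesis by simp
qed

section \<open>Random decisions: measurability, noise and linearized regret in expectation\<close>

locale sea_optimistic_ftrl = sea_model M X S grad f \<DD> T
  for M :: "'w measure" and X :: "'a::euclidean_space set" and S grad f \<DD> T +
  fixes lam :: real and x0 :: 'a and x :: "nat \<Rightarrow> 'w \<Rightarrow> 'a"
  assumes lam_pos: "lam > 0"
    and algorithm: "\<And>w. w \<in> space M \<Longrightarrow>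
      optimistic_ftrl X grad lam x0 T (\<lambda>t. f t w) (\<lambda>t. x t w)"
begin

lemmas decision_arg_min = optimistic_ftrl_arg_min[OF algorithm]

lemma decision_in:
  assumes "t \<in> {1..T}" "w \<in> space M"
  shows "x t w \<in> X"
  using decision_arg_min[OF assms(2), of "t - 1"] assms(1) by (auto simp: is_arg_min_linorder)

lemma eval_measurable_at:
  assumes "F \<in> N \<rightarrow>\<^sub>M S" "z \<in> borel_measurable N" "\<And>w. w \<in> space N \<Longrightarrow> z w \<in> X"
  shows "(\<lambda>w. F w (z w)) \<in> borel_measurable N"
proof -
  have "(\<lambda>w. (F w, z w)) \<in> N \<rightarrow>\<^sub>M S \<Otimes>\<^sub>M restrict_space borel X"
    using assms by (intro measurable_Pair measurable_restrict_space2) auto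
  from measurable_compose[OF this eval_measurable] show ?thesis by simp
qed

lemma grad_measurable_at:
  assumes "F \<in> N \<rightarrow>\<^sub>M S" "z \<in> borel_measurable N" "\<And>w. w \<in> space N \<Longrightarrow> z w \<in> X"
  shows "(\<lambda>w. grad (F w) (z w)) \<in> borel_measurable N"
proof -
  have "(\<lambda>w. (F w, z w)) \<in> N \<rightarrow>\<^sub>M S \<Otimes>\<^sub>M restrict_space borel X"
    using assms by (intro measurable_Pair measurable_restrict_space2) auto
  from measurable_compose[OF this grad_measurable] show ?thesis by simp
qed

lemma past_mono:
  assumes "s \<le> t" "t \<le> T"
  shows "subalgebra (past M S f \<DD> t) (past M S f \<DD> s)"
proof -
  have "s \<le> T" using assms by simp
  then show ?thesis
    unfolding subalgebra_def sets_past[OF assms(2)] sets_past[OF \<open>s \<le> T\<close>] space_past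
    using assms(1) by (intro conjI refl sigma_sets_mono' Un_mono UN_mono) auto
qed

text \<open>Each decision is the projection onto \<open>X\<close> of a linear combination of earlier decisions and
  gradients, hence measurable.\<close>

lemma decision_measurable_past:
  "t \<in> {1..T} \<Longrightarrow> x t \<in> borel_measurable (past M S f \<DD> t)"
proof (induction t rule: less_induct)
  case (less t)
  then obtain n where n: "t = Suc n" "n < T" by (cases t) auto
  let ?F = "past M S f \<DD> t"
  have x: "x s \<in> borel_measurable ?F" if "s \<in> {1..n}" for s
    using less.IH[of s] less.prems that n
    by (intro measurable_from_subalg[OF past_mono[of s t]]) auto
  have g: "(\<lambda>w. grad (f s w) (x s w)) \<in> borel_measurable ?F" if "s \<in> {1..n}" for s
    using that n less.prems
    by (intro grad_measurable_at fun_measurable_past x) (auto intro!: decision_in)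
  define c where "c w = (\<Sum>s=1..n. grad (f s w) (x s w) - lam *\<^sub>R x s w) - lam *\<^sub>R x0
      + (if n = 0 then 0 else grad (f n w) (x n w))" for w
  have c: "c \<in> borel_measurable ?F"
  proof -
    have "(\<lambda>w. if n = 0 then 0 else grad (f n w) (x n w)) \<in> borel_measurable ?F"
      using g[of n] by (cases n) auto
    then show ?thesis
      unfolding c_def using x g
      by (intro borel_measurable_add borel_measurable_diff borel_measurable_sum
          borel_measurable_scaleR) auto
  qed
  have "closest_point X \<in> borel_measurable borel"
    using domain by (intro borel_measurable_continuous_onI continuous_on_closest_point)
  moreover have "(\<lambda>w. - (c w /\<^sub>R (lam * (real n + 1)))) \<in> borel_measurable ?F"
    using c by measurable
  ultimately have m: "(\<lambda>w. closest_point X (- (c w /\<^sub>R (lam * (real n + 1))))) \<in> borel_measurable ?F"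
    by (rule measurable_compose[rotated])
  have "x t w = closest_point X (- (c w /\<^sub>R (lam * (real n + 1))))" if "w \<in> space ?F" for w
    using ftrl_arg_min(1)[OF domain(2,3) lam_pos decision_arg_min[of w n]] that n
    by (simp add: c_def)
  then show ?case by (rule measurable_cong[THEN iffD2, OF _ m])
qed

lemma decision_measurable: "t \<in> {1..T} \<Longrightarrow> x t \<in> borel_measurable M"
  using decision_measurable_past[of t] subalgebra_past[of t] by (auto intro: measurable_from_subalg)

lemma decision_measurable_past_domain:
  "t \<in> {1..T} \<Longrightarrow> x t \<in> past M S f \<DD> t \<rightarrow>\<^sub>M restrict_space borel X"
  using decision_measurable_past by (intro measurable_restrict_space2) (auto intro: decision_in)

text \<open>The gradient of the expected function at the decision is a random variable only up to a null
  set; this is a measurable version of it.\<close>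

definition mean_grad :: "nat \<Rightarrow> 'w \<Rightarrow> 'a" where
  "mean_grad t w = (\<integral>\<phi>. grad \<phi> (x t w) \<partial>\<DD> t w)"

lemma mean_grad_eq:
  "AE w in M. \<forall>t\<in>{1..T}. grad_exp_fun grad \<DD> t w (x t w) = mean_grad t w"
  using interchange AE_space
  by eventually_elim (auto simp: mean_grad_def grad_exp_fun_def decision_in)

text \<open>Both ingredients are known before the draw: the decision depends on earlier functions,
  and the past of round \<open>t\<close> contains \<open>\<DD> t\<close> itself.\<close>

lemma mean_grad_measurable_past:
  assumes t: "t \<in> {1..T}"
  shows "mean_grad t \<in> borel_measurable (past M S f \<DD> t)"
proof -
  let ?F = "past M S f \<DD> t"
  have "(\<lambda>p. grad (snd p) (x t (fst p))) \<in> borel_measurable (?F \<Otimes>\<^sub>M S)"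
  proof (rule grad_measurable_at)
    show "(\<lambda>p. x t (fst p)) \<in> borel_measurable (?F \<Otimes>\<^sub>M S)"
      using decision_measurable_past[OF t] by measurable
    show "x t (fst p) \<in> X" if "p \<in> space (?F \<Otimes>\<^sub>M S)" for p
      using that decision_in[OF t] by (auto simp: space_pair_measure)
  qed simp
  from integral_measurable_subprob_algebra2[OF this measurable_prob_algebraD[OF distr_measurable_past[OF t]]]
  show ?thesis by (simp add: mean_grad_def[abs_def])
qed

lemma grad_decision_measurable:
  assumes t: "t \<in> {1..T}"
  shows "(\<lambda>w. grad (f t w) (x t w)) \<in> borel_measurable M"
  by (intro grad_measurable_at fun_measurable[OF t] decision_measurable[OF t] decision_in[OF t])

text \<open>The decision and the mean gradient are fixed before \<open>f t\<close> is drawn, so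
  conditioning yields the variance at one point of \<open>X\<close>, a member of the supremum in
  \<open>stoch_var\<close>.\<close>

lemma nn_integral_noise_le:
  assumes t: "t \<in> {1..T}"
  shows "(\<integral>\<^sup>+w. ennreal ((norm (grad (f t w) (x t w) - mean_grad t w))\<^sup>2) \<partial>M)
    \<le> (\<integral>\<^sup>+w. stoch_var X grad \<DD> t w \<partial>M)"
proof -
  let ?N = "restrict_space borel X \<Otimes>\<^sub>M (borel :: 'a measure)"
  define h :: "('a \<Rightarrow> real) \<times> ('a \<times> 'a) \<Rightarrow> ennreal"
    where "h p = ennreal ((norm (grad (fst p) (fst (snd p)) - snd (snd p)))\<^sup>2)" for p
  have "(\<lambda>p. grad (fst p) (fst (snd p))) \<in> borel_measurable (S \<Otimes>\<^sub>M ?N)"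
    by (rule grad_measurable_at) (auto simp: space_pair_measure space_restrict_space
        intro!: measurable_compose[OF measurable_snd] measurable_compose[OF measurable_fst]
          measurable_restrict_space1)
  then have h: "h \<in> borel_measurable (S \<Otimes>\<^sub>M ?N)" unfolding h_def by measurable
  have Z: "(\<lambda>w. (x t w, mean_grad t w)) \<in> past M S f \<DD> t \<rightarrow>\<^sub>M ?N"
    using decision_measurable_past_domain[OF t] mean_grad_measurable_past[OF t] by measurable
  have "(\<integral>\<^sup>+w. ennreal ((norm (grad (f t w) (x t w) - mean_grad t w))\<^sup>2) \<partial>M)
      = (\<integral>\<^sup>+w. \<integral>\<^sup>+\<phi>. ennreal ((norm (grad \<phi> (x t w) - mean_grad t w))\<^sup>2) \<partial>\<DD> t w \<partial>M)"
    using nn_integral_conditional_law[OF t Z h] by (simp add: h_def)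
  also have "\<dots> \<le> (\<integral>\<^sup>+w. stoch_var X grad \<DD> t w \<partial>M)"
  proof (rule nn_integral_mono_AE)
    show "AE w in M. (\<integral>\<^sup>+\<phi>. ennreal ((norm (grad \<phi> (x t w) - mean_grad t w))\<^sup>2) \<partial>\<DD> t w)
        \<le> stoch_var X grad \<DD> t w"
      using mean_grad_eq AE_space
    proof eventually_elim
      case (elim w)
      then have "mean_grad t w = grad_exp_fun grad \<DD> t w (x t w)" "x t w \<in> X"
        using t by (auto intro: decision_in)
      then show ?case unfolding stoch_var_def by (auto intro!: SUP_upper)
    qed
  qed
  finally show ?thesis .
qed

text \<open>Strong convexity enters only through the conditional expectation over the individual
  function, which is why the bound holds on average but not for each individual function.\<close>

lemma expected_regret_le_linearized:
  assumes t: "t \<in> {1..T}" and u: "u \<in> X"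
    and bounded_gradients: "AE w in M. \<forall>t\<in>{1..T}. \<forall>y\<in>X. norm (grad (f t w) y) \<le> G"
    and bounded_domain: "\<And>y z. y \<in> X \<Longrightarrow> z \<in> X \<Longrightarrow> norm (y - z) \<le> D"
    and strongly_convex: "AE w in M. \<forall>t\<in>{1..T}. strongly_convex_on X lam (exp_fun \<DD> t w)"
  shows "integrable M (\<lambda>w. f t w (x t w) - f t w u)"
    and "integrable M (\<lambda>w. grad (f t w) (x t w) \<bullet> (x t w - u) - lam / 2 * (norm (u - x t w))\<^sup>2)"
    and "(\<integral>w. f t w (x t w) - f t w u \<partial>M)
      \<le> (\<integral>w. grad (f t w) (x t w) \<bullet> (x t w - u) - lam / 2 * (norm (u - x t w))\<^sup>2 \<partial>M)"
proof -
  note [measurable] = decision_measurable[OF t] grad_decision_measurable[OF t]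
    eval_measurable_at[OF fun_measurable[OF t] decision_measurable[OF t] decision_in[OF t]]
    eval_measurable_at[OF fun_measurable[OF t] measurable_const u, simplified]
  have fb: "AE w in M. \<bar>f t w (x t w) - f t w u\<bar> \<le> G * D"
    using bounded_gradients AE_space
  proof eventually_elim
    case (elim w)
    have xX: "x t w \<in> X" using t elim by (intro decision_in) auto
    have "f t w \<in> space S" using measurable_space[OF fun_measurable[OF t]] elim by auto
    then have "\<bar>f t w (x t w) - f t w u\<bar> \<le> G * norm (x t w - u)"
      using elim t u xX
      by (intro lipschitz_of_gradient_bound[OF gradient domain(3)] differentiable) auto
    also have "0 \<le> G" using elim t xX norm_ge_zero order_trans by blast
    then have "G * norm (x t w - u) \<le> G * D"
      by (intro mult_left_mono bounded_domain xX u)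
    finally show ?case .
  qed
  have gb: "AE w in M. \<bar>grad (f t w) (x t w) \<bullet> (x t w - u) - lam / 2 * (norm (u - x t w))\<^sup>2\<bar>
      \<le> G * D + lam / 2 * D\<^sup>2"
    using bounded_gradients AE_space
  proof eventually_elim
    case (elim w)
    have xX: "x t w \<in> X" using t elim by (intro decision_in) auto
    have G: "norm (grad (f t w) (x t w)) \<le> G" using elim t xX by auto
    have "\<bar>grad (f t w) (x t w) \<bullet> (x t w - u)\<bar> \<le> norm (grad (f t w) (x t w)) * norm (x t w - u)"
      by (rule Cauchy_Schwarz_ineq2)
    also have "\<dots> \<le> G * D"
      using G order_trans[OF norm_ge_zero G] by (intro mult_mono bounded_domain xX u) auto
    finally have "\<bar>grad (f t w) (x t w) \<bullet> (x t w - u)\<bar> \<le> G * D" .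
    moreover have "lam / 2 * (norm (u - x t w))\<^sup>2 \<le> lam / 2 * D\<^sup>2"
      using lam_pos by (intro mult_left_mono power_mono bounded_domain xX u) auto
    moreover have "0 \<le> lam / 2 * (norm (u - x t w))\<^sup>2" using lam_pos by simp
    ultimately show ?case by linarith
  qed
  show int_f: "integrable M (\<lambda>w. f t w (x t w) - f t w u)"
    using fb by (intro integrable_const_bound[where B = "G * D"]) auto
  show int_g: "integrable M (\<lambda>w. grad (f t w) (x t w) \<bullet> (x t w - u) - lam / 2 * (norm (u - x t w))\<^sup>2)"
    using gb by (intro integrable_const_bound[where B = "G * D + lam / 2 * D\<^sup>2"]) auto
  \<comment> \<open>The excess of the regret of one function over its linearized regret, as a
    function of the drawn function and the decision. Its mean under \<open>\<DD> t w\<close> is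
    nonpositive by strong convexity of the expected function.\<close>
  define h where "h p = (fst p (snd p) - fst p u)
      - (grad (fst p) (snd p) \<bullet> (snd p - u) - lam / 2 * (norm (u - snd p))\<^sup>2)"
    for p :: "('a \<Rightarrow> real) \<times> 'a"
  have snd_m: "snd \<in> borel_measurable (S \<Otimes>\<^sub>M restrict_space borel X)"
    by (rule measurable_compose[OF measurable_snd measurable_restrict_space1]) simp
  have h: "h \<in> borel_measurable (S \<Otimes>\<^sub>M restrict_space borel X)"
  proof -
    note [measurable] = snd_m
    have [measurable]: "(\<lambda>p. fst p (snd p)) \<in> borel_measurable (S \<Otimes>\<^sub>M restrict_space borel X)"
      "(\<lambda>p. grad (fst p) (snd p)) \<in> borel_measurable (S \<Otimes>\<^sub>M restrict_space borel X)"
      using eval_measurable grad_measurable by (simp_all add: case_prod_beta')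
    have [measurable]: "(\<lambda>p. fst p u) \<in> borel_measurable (S \<Otimes>\<^sub>M restrict_space borel X)"
      by (rule eval_measurable_at) (use u in auto)
    show ?thesis unfolding h_def by measurable
  qed
  have "AE w in M. \<bar>h (f t w, x t w)\<bar> \<le> G * D + (G * D + lam / 2 * D\<^sup>2)"
    using fb gb by eventually_elim (unfold h_def fst_conv snd_conv, linarith)
  moreover have "AE w in M. integrable (\<DD> t w) (\<lambda>\<phi>. h (\<phi>, x t w)) \<and> (\<integral>\<phi>. h (\<phi>, x t w) \<partial>\<DD> t w) \<le> 0"
    using exp_fun_integrable exp_fun_differentiable interchange strongly_convex AE_space
  proof eventually_elim
    case (elim w)
    interpret D: prob_space "\<DD> t w" by (rule prob_space_distr_round[OF t]) (use elim in auto)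
    have xX: "x t w \<in> X" using t elim by (intro decision_in) auto
    have i: "integrable (\<DD> t w) (\<lambda>\<phi>. \<phi> (x t w))" "integrable (\<DD> t w) (\<lambda>\<phi>. \<phi> u)"
      "integrable (\<DD> t w) (\<lambda>\<phi>. grad \<phi> (x t w))"
      using elim t xX u by auto
    have "exp_fun \<DD> t w differentiable (at (x t w) within X)"
      using elim t xX by (auto simp: differentiable_on_def)
    then have "(exp_fun \<DD> t w has_derivative (\<lambda>h. grad (exp_fun \<DD> t w) (x t w) \<bullet> h))
        (at (x t w) within X)"
      using gradient xX unfolding gradient_operator_on_def by blast
    then have "exp_fun \<DD> t w (x t w) + grad (exp_fun \<DD> t w) (x t w) \<bullet> (u - x t w)
        + lam / 2 * (norm (u - x t w))\<^sup>2 \<le> exp_fun \<DD> t w u"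
      using elim t xX u domain(3) by (intro strongly_convex_on_gradient) auto
    moreover have "grad (exp_fun \<DD> t w) (x t w) = (\<integral>\<phi>. grad \<phi> (x t w) \<partial>\<DD> t w)"
      using elim t xX by auto
    ultimately have "exp_fun \<DD> t w (x t w) - exp_fun \<DD> t w u
      - ((\<integral>\<phi>. grad \<phi> (x t w) \<partial>\<DD> t w) \<bullet> (x t w - u) - lam / 2 * (norm (u - x t w))\<^sup>2) \<le> 0"
      by (simp add: inner_diff_right)
    also have "exp_fun \<DD> t w (x t w) - exp_fun \<DD> t w u
      - ((\<integral>\<phi>. grad \<phi> (x t w) \<partial>\<DD> t w) \<bullet> (x t w - u) - lam / 2 * (norm (u - x t w))\<^sup>2)
      = (\<integral>\<phi>. h (\<phi>, x t w) \<partial>\<DD> t w)"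
      unfolding h_def using i by (simp add: exp_fun_def D.prob_space)
    finally show ?case unfolding h_def using i by simp
  qed
  ultimately have "(\<integral>w. h (f t w, x t w) \<partial>M) \<le> 0"
    by (rule integral_conditional_law_nonpos[OF t decision_measurable_past_domain[OF t] h])
  then show "(\<integral>w. f t w (x t w) - f t w u \<partial>M)
      \<le> (\<integral>w. grad (f t w) (x t w) \<bullet> (x t w - u) - lam / 2 * (norm (u - x t w))\<^sup>2 \<partial>M)"
    unfolding h_def fst_conv snd_conv using int_f int_g
    by (subst (asm) Bochner_Integration.integral_diff) auto
qed

end

section \<open>Averaging the pathwise bound\<close>

theorem theorem4:
  fixes M :: "'w measure"
    and X :: "'a::euclidean_space set"
    and S :: "('a \<Rightarrow> real) measure"
    and grad :: "('a \<Rightarrow> real) \<Rightarrow> 'a \<Rightarrow> 'a"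
    and f :: "nat \<Rightarrow> 'w \<Rightarrow> 'a \<Rightarrow> real"
    and \<DD> :: "nat \<Rightarrow> 'w \<Rightarrow> ('a \<Rightarrow> real) measure"
    and T :: nat
    and x :: "nat \<Rightarrow> 'w \<Rightarrow> 'a"
    and x0 u :: 'a
    and G D L lam \<sigma>max2 \<Sigma>max2 :: real
  assumes model: "sea_model M X S grad f \<DD> T"
    and constants: "G > 0" "D > 0" "L > 0" "lam > 0"
      "\<sigma>max2 \<ge> 0" "\<Sigma>max2 \<ge> 0" "\<sigma>max2 + \<Sigma>max2 > 0"
    and bounded_gradients:
      "AE w in M. \<forall>t\<in>{1..T}. \<forall>y\<in>X. norm (grad (f t w) y) \<le> G"
    and bounded_domain: "0 \<in> X" "\<And>y z. y \<in> X \<Longrightarrow> z \<in> X \<Longrightarrow> norm (y - z) \<le> D"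
    and max_variations:
      "AE w in M. \<forall>t\<in>{1..T}. stoch_var X grad \<DD> t w \<le> ennreal \<sigma>max2 \<and>
         adv_var X grad \<DD> t w \<le> ennreal \<Sigma>max2"
    and smooth:
      "AE w in M. \<forall>t\<in>{1..T}. \<forall>y\<in>X. \<forall>z\<in>X.
         norm (grad_exp_fun grad \<DD> t w y - grad_exp_fun grad \<DD> t w z) \<le> L * norm (y - z)"
    and strongly_convex:
      "AE w in M. \<forall>t\<in>{1..T}. strongly_convex_on X lam (exp_fun \<DD> t w)"
    and x0: "x0 \<in> X"
    and algorithm:
      "\<And>w. w \<in> space M \<Longrightarrow>
         optimistic_ftrl X grad lam x0 T (\<lambda>t. f t w) (\<lambda>t. x t w)"
    and u: "u \<in> X"
  shows "integrable M (\<lambda>w. (\<Sum>t=1..T. f t w (x t w)) - (\<Sum>t=1..T. f t w u)) \<and>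
    (\<integral>w. (\<Sum>t=1..T. f t w (x t w)) - (\<Sum>t=1..T. f t w u) \<partial>M)
      \<le> 16 / lam * (\<sigma>max2 + \<Sigma>max2)
          * ln (1 + (cum_stoch_var M X grad \<DD> T + cum_adv_var M X grad \<DD> T) / (\<sigma>max2 + \<Sigma>max2))
        + (lam * D\<^sup>2 + G\<^sup>2 / lam + 32 * (\<sigma>max2 + \<Sigma>max2) / lam + 16 * L ^ 3 * D\<^sup>2 / lam\<^sup>2)"
proof -
  interpret sea_optimistic_ftrl M X S grad f \<DD> T lam x0 x
    using model constants(4) algorithm
    by (simp add: sea_optimistic_ftrl_def sea_optimistic_ftrl_axioms_def)
  define A where "A = \<sigma>max2 + \<Sigma>max2"
  define g where "g t w = grad (f t w) (x t w)" for t w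
  define lin where "lin t w = g t w \<bullet> (x t w - u) - lam / 2 * (norm (u - x t w))\<^sup>2" for t w
  define e where "e t w = (norm (g t w - mean_grad t w))\<^sup>2" for t w
  \<comment> \<open>The default 0 of \<open>enn2real\<close> at infinity occurs only on a null set,
    because the drift is almost surely at most \<open>\<Sigma>max2\<close>.\<close>
  define v where "v t w = enn2real (adv_var X grad \<DD> t w)" for t w
  define b where "b t = enn2real (\<integral>\<^sup>+w. stoch_var X grad \<DD> t w \<partial>M)" for t
  define c where "c t = enn2real (\<integral>\<^sup>+w. adv_var X grad \<DD> t w \<partial>M)" for t
  define C where "C = lam / 2 * D\<^sup>2 + G\<^sup>2 / (2 * lam) + 8 * L ^ 3 * D\<^sup>2 / lam\<^sup>2"
  note linearized = expected_regret_le_linearized[OF _ u bounded_gradients bounded_domain(2)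
      strongly_convex, folded g_def, folded lin_def]

  have adv_finite: "AE w in M. \<forall>t\<in>{1..T}. adv_var X grad \<DD> t w = ennreal (v t w)"
    using max_variations
  proof eventually_elim
    case (elim w)
    have "adv_var X grad \<DD> t w < \<top>" if "t \<in> {1..T}" for t
    proof -
      have "adv_var X grad \<DD> t w \<le> ennreal \<Sigma>max2" using elim that by blast
      also have "\<dots> < \<top>" by simp
      finally show ?thesis .
    qed
    then show ?case unfolding v_def by (metis ennreal_enn2real)
  qed

  \<comment> \<open>For almost every outcome the deterministic analysis applies, with the gradients
    of the expected functions as \<open>H\<close>; it bounds the linearized regret.\<close>
  have pathwise: "AE w in M. (\<Sum>t=1..T. lin t w) \<le> C + 8 / lam * (\<Sum>t=1..T. (e t w + v t w) / (real t + 1))"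
    using bounded_gradients adv_finite smooth mean_grad_eq AE_space
  proof eventually_elim
    case (elim w)
    have w: "w \<in> space M" using elim by simp
    have drift: "(norm (grad_exp_fun grad \<DD> t w (x t w) - grad_exp_fun grad \<DD> (t - 1) w (x t w)))\<^sup>2
        \<le> v t w" if t: "t \<in> {2..T}" for t
    proof -
      have t': "t \<in> {1..T}" using t by simp
      have "ennreal ((norm (grad_exp_fun grad \<DD> t w (x t w) - grad_exp_fun grad \<DD> (t - 1) w (x t w)))\<^sup>2)
          \<le> adv_var X grad \<DD> t w"
        unfolding adv_var_def by (intro SUP_upper decision_in[OF t' w])
      also have "adv_var X grad \<DD> t w = ennreal (v t w)"
        using elim t' by auto
      finally show ?thesis by (simp add: v_def)
    qed
    have G1: "norm (g 1 w) \<le> G"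
      unfolding g_def using elim horizon decision_in[OF _ w, of 1] by auto
    have "(\<Sum>t=1..T. lin t w)
        \<le> C + 8 / lam * (\<Sum>t=1..T. ((norm (g t w - grad_exp_fun grad \<DD> t w (x t w)))\<^sup>2 + v t w) / (real t + 1))"
      unfolding lin_def C_def
      by (rule optimistic_ftrl_regret_variation[OF domain(2,3) constants(4,3) x0 u bounded_domain(2)
            decision_arg_min[OF w, folded g_def] horizon G1])
        (use elim drift in \<open>auto simp: v_def\<close>)
    \<comment> \<open>The gradient of the expected function is exchanged for its measurable version,
      so that the noise can be integrated.\<close>
    also have "(\<Sum>t=1..T. ((norm (g t w - grad_exp_fun grad \<DD> t w (x t w)))\<^sup>2 + v t w) / (real t + 1))
        = (\<Sum>t=1..T. (e t w + v t w) / (real t + 1))"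
      using elim by (intro sum.cong) (auto simp: e_def)
    finally show ?case .
  qed

  \<comment> \<open>The uniform bound makes the integral finite, so passing to the real number
    \<open>b t\<close> loses nothing; the same is done for the drift with
    \<open>c t\<close>.\<close>
  have stoch: "(\<integral>\<^sup>+w. stoch_var X grad \<DD> t w \<partial>M) = ennreal (b t)" "b t \<le> \<sigma>max2" if "t \<in> {1..T}" for t
  proof -
    have "(\<integral>\<^sup>+w. stoch_var X grad \<DD> t w \<partial>M) \<le> (\<integral>\<^sup>+w. ennreal \<sigma>max2 \<partial>M)"
      using max_variations that by (intro nn_integral_mono_AE) auto
    then have le: "(\<integral>\<^sup>+w. stoch_var X grad \<DD> t w \<partial>M) \<le> ennreal \<sigma>max2"
      by (simp add: emeasure_space_1)
    then show eq: "(\<integral>\<^sup>+w. stoch_var X grad \<DD> t w \<partial>M) = ennreal (b t)"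
      unfolding b_def by (intro ennreal_enn2real[symmetric]) (auto intro: le_less_trans)
    show "b t \<le> \<sigma>max2" using le constants(5) unfolding eq by simp
  qed
  have adv: "(\<integral>\<^sup>+w. adv_var X grad \<DD> t w \<partial>M) = ennreal (c t)" "c t \<le> \<Sigma>max2" if "t \<in> {1..T}" for t
  proof -
    have "(\<integral>\<^sup>+w. adv_var X grad \<DD> t w \<partial>M) \<le> (\<integral>\<^sup>+w. ennreal \<Sigma>max2 \<partial>M)"
      using max_variations that by (intro nn_integral_mono_AE) auto
    then have le: "(\<integral>\<^sup>+w. adv_var X grad \<DD> t w \<partial>M) \<le> ennreal \<Sigma>max2"
      by (simp add: emeasure_space_1)
    then show eq: "(\<integral>\<^sup>+w. adv_var X grad \<DD> t w \<partial>M) = ennreal (c t)"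
      unfolding c_def by (intro ennreal_enn2real[symmetric]) (auto intro: le_less_trans)
    show "c t \<le> \<Sigma>max2" using le constants(6) unfolding eq by simp
  qed
  have nonneg: "0 \<le> b t" "0 \<le> c t" for t by (simp_all add: b_def c_def)

  have noise: "integrable M (e t)" "(\<integral>w. e t w \<partial>M) \<le> b t" if t: "t \<in> {1..T}" for t
  proof -
    have [measurable]: "e t \<in> borel_measurable M"
      using grad_decision_measurable[OF t] subalgebra_past[of t] t
        measurable_from_subalg[OF subalgebra_past mean_grad_measurable_past[OF t]]
      unfolding e_def g_def by auto
    have le: "(\<integral>\<^sup>+w. ennreal (e t w) \<partial>M) \<le> ennreal (b t)"
      using nn_integral_noise_le[OF t] stoch(1)[OF t] by (simp add: e_def g_def)
    show int: "integrable M (e t)"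
      using le by (intro integrableI_nonneg) (auto simp: e_def intro: le_less_trans)
    have "ennreal (\<integral>w. e t w \<partial>M) \<le> ennreal (b t)"
      using le int by (subst nn_integral_eq_integral[symmetric]) (auto simp: e_def)
    then show "(\<integral>w. e t w \<partial>M) \<le> b t" using nonneg by simp
  qed
  have drift: "integrable M (v t)" "(\<integral>w. v t w \<partial>M) = c t" if t: "t \<in> {1..T}" for t
  proof -
    have [measurable]: "v t \<in> borel_measurable M"
      using adv_var_measurable[OF t] unfolding v_def by measurable
    have "(\<integral>\<^sup>+w. ennreal (v t w) \<partial>M) = (\<integral>\<^sup>+w. adv_var X grad \<DD> t w \<partial>M)"
      using adv_finite t by (intro nn_integral_cong_AE) (auto elim!: eventually_mono)
    then have eq: "(\<integral>\<^sup>+w. ennreal (v t w) \<partial>M) = ennreal (c t)" using adv(1)[OF t] by simp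
    show "integrable M (v t)"
      using eq by (intro integrableI_nonneg) (auto simp: v_def)
    show "(\<integral>w. v t w \<partial>M) = c t"
      using eq nonneg by (subst integral_eq_nn_integral) (auto simp: v_def)
  qed

  have "(\<integral>w. (\<Sum>t=1..T. lin t w) \<partial>M)
      \<le> (\<integral>w. C + 8 / lam * (\<Sum>t=1..T. (e t w + v t w) / (real t + 1)) \<partial>M)"
    using pathwise linearized(2) noise(1) drift(1)
    by (intro integral_mono_AE Bochner_Integration.integrable_add integrable_mult_right
        Bochner_Integration.integrable_sum integrable_divide_zero) auto
  also have "\<dots> = C + 8 / lam * (\<Sum>t=1..T. ((\<integral>w. e t w \<partial>M) + (\<integral>w. v t w \<partial>M)) / (real t + 1))"
  proof -
    have sum_int: "integrable M (\<lambda>w. (e t w + v t w) / (real t + 1))" if "t \<in> {1..T}" for t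
      using noise(1)[OF that] drift(1)[OF that]
      by (intro integrable_divide_zero Bochner_Integration.integrable_add)
    have "(\<integral>w. C + 8 / lam * (\<Sum>t=1..T. (e t w + v t w) / (real t + 1)) \<partial>M)
        = C + 8 / lam * (\<Sum>t=1..T. \<integral>w. (e t w + v t w) / (real t + 1) \<partial>M)"
      using sum_int
      by (subst Bochner_Integration.integral_add)
        (auto simp: prob_space Bochner_Integration.integral_sum
          intro!: integrable_mult_right Bochner_Integration.integrable_sum)
    also have "(\<Sum>t=1..T. \<integral>w. (e t w + v t w) / (real t + 1) \<partial>M)
        = (\<Sum>t=1..T. ((\<integral>w. e t w \<partial>M) + (\<integral>w. v t w \<partial>M)) / (real t + 1))"
      using noise(1) drift(1) by (intro sum.cong) auto
    finally show ?thesis .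
  qed
  also have "\<dots> \<le> C + 8 / lam * (\<Sum>t=1..T. (b t + c t) / (real t + 1))"
    using noise(2) drift(2) lam_pos
    by (intro add_left_mono mult_left_mono sum_mono divide_right_mono add_mono) auto
  \<comment> \<open>The logarithmic sum bound is applied to the expectations
    \<open>b t + c t\<close>, each at most \<open>A\<close>, so the logarithm contains expected
    variations without an appeal to Jensen's inequality.\<close>
  also have "\<dots> \<le> C + 8 / lam * (A * ln (1 + (\<Sum>t=1..T. b t + c t) / A))"
    using lam_pos constants(7) stoch(2) adv(2) nonneg
    by (intro add_left_mono mult_left_mono sum_weighted_le_ln) (auto simp: A_def add_mono)
  \<comment> \<open>The logarithmic term is nonnegative, so doubling its coefficient and the
    constants in \<open>C\<close> only enlarges the bound.\<close>
  also have "\<dots> \<le> 16 / lam * A * ln (1 + (\<Sum>t=1..T. b t + c t) / A)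
        + (lam * D\<^sup>2 + G\<^sup>2 / lam + 32 * A / lam + 16 * L ^ 3 * D\<^sup>2 / lam\<^sup>2)"
  proof -
    have "0 \<le> (\<Sum>t=1..T. b t + c t) / A"
      using constants(7) nonneg by (intro divide_nonneg_pos sum_nonneg) (auto simp: A_def)
    then have ln0: "0 \<le> A * ln (1 + (\<Sum>t=1..T. b t + c t) / A)"
      using constants(7) by (simp add: A_def)
    have combine: "p + q + r + l \<le> l' + (p' + q' + k + r')"
      if "p \<le> p'" "q \<le> q'" "r \<le> r'" "l \<le> l'" "0 \<le> k" for p q r l p' q' r' l' k :: real
      using that by linarith
    show ?thesis
      unfolding C_def
    proof (rule combine)
      show "lam / 2 * D\<^sup>2 \<le> lam * D\<^sup>2" using constants by simp
      show "G\<^sup>2 / (2 * lam) \<le> G\<^sup>2 / lam" using constants by (intro divide_left_mono) auto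
      show "8 * L ^ 3 * D\<^sup>2 / lam\<^sup>2 \<le> 16 * L ^ 3 * D\<^sup>2 / lam\<^sup>2"
        using constants by (intro divide_right_mono mult_right_mono) auto
      show "8 / lam * (A * ln (1 + (\<Sum>t=1..T. b t + c t) / A))
          \<le> 16 / lam * A * ln (1 + (\<Sum>t=1..T. b t + c t) / A)"
        unfolding mult.assoc[of _ A]
        using ln0 constants by (intro mult_right_mono divide_right_mono) auto
      show "0 \<le> 32 * A / lam" using constants by (simp add: A_def)
    qed
  qed
  \<comment> \<open>All summands are finite, so sum and integral may be exchanged in the extended
    reals before converting to real numbers.\<close>
  also have "(\<Sum>t=1..T. b t + c t) = cum_stoch_var M X grad \<DD> T + cum_adv_var M X grad \<DD> T"
  proof -
    have "cum_stoch_var M X grad \<DD> T = (\<Sum>t=1..T. b t)"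
      unfolding cum_stoch_var_def using stoch(1) nonneg
      by (subst nn_integral_sum) (auto simp: stoch_var_measurable sum_nonneg)
    moreover have "cum_adv_var M X grad \<DD> T = (\<Sum>t=1..T. c t)"
      unfolding cum_adv_var_def using adv(1) nonneg
      by (subst nn_integral_sum) (auto simp: adv_var_measurable sum_nonneg)
    ultimately show ?thesis by (simp add: sum.distrib)
  qed
  finally have bound: "(\<integral>w. (\<Sum>t=1..T. lin t w) \<partial>M) \<le> 16 / lam * A
          * ln (1 + (cum_stoch_var M X grad \<DD> T + cum_adv_var M X grad \<DD> T) / A)
        + (lam * D\<^sup>2 + G\<^sup>2 / lam + 32 * A / lam + 16 * L ^ 3 * D\<^sup>2 / lam\<^sup>2)" .

  have split: "(\<Sum>t=1..T. f t w (x t w)) - (\<Sum>t=1..T. f t w u) = (\<Sum>t=1..T. f t w (x t w) - f t w u)" for w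
    by (simp add: sum_subtractf)
  have "(\<integral>w. (\<Sum>t=1..T. f t w (x t w) - f t w u) \<partial>M) \<le> (\<integral>w. (\<Sum>t=1..T. lin t w) \<partial>M)"
    using linearized by (subst (1 2) Bochner_Integration.integral_sum) (auto intro!: sum_mono)
  with bound show ?thesis
    unfolding split A_def using linearized(1) by (auto intro!: Bochner_Integration.integrable_sum)
qed

end
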